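(* Let the random vector $\boldsymbol{X}=(X_1,\dots,X_d)$ follow a copula $C$ on $\mathbb{R}^d$, and suppose there is a $D$-norm $\|\cdot\|_D$ on $\mathbb{R}^d$ such that $$C(\boldsymbol{u})=1-\|\boldsymbol{1}-\boldsymbol{u}\|_D+o(\|\boldsymbol{1}-\boldsymbol{u}\|)\quad\text{as }\boldsymbol{u}\to\boldsymbol{1},\ \text{uniformly for }\boldsymbol{u}\in[0,1]^d .$$ Let $\boldsymbol{X}^{(1)},\boldsymbol{X}^{(2)},\dots$ be independent copies of $\boldsymbol{X}$. Let $\boldsymbol{k}=\boldsymbol{k}(n)=(k_1,\dots,k_d)\in\{1,\dots,n-1\}^d$ be such that, as $n\to\infty$, $k_i/k_j\to k_{ij}^2\in(0,\infty)$ (with $k_{ij}>0$) for all pairs $1\le i,j\le d$, $\|\boldsymbol{k}\|\to\infty$ and $\|\boldsymbol{k}\|/n\to 0$. Then the vector of componentwise intermediate order statistics is asymptotically normal: $$\left(\frac{n}{\sqrt{k_i}}\left(X_{n-k_i:n,i}-\frac{n-k_i}{n}\right)\right)_{i=1}^d\to_D N(\boldsymbol{0},\Sigma)\qquad (n\to\infty),$$ where the $d\times d$ covariance matrix $\Sigma=(\sigma_{ij})$ is given by $$\sigma_{ij}=\begin{cases}1,&\text{if } i=j,\\ k_{ij}+k_{ji}-\|k_{ij}\boldsymbol{e}_i+k_{ji}\boldsymbol{e}_j\|_D,&\text{if } i\neq j.\end{cases}$$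
   Context: A copula on $\mathbb{R}^d$ is the distribution function of a random vector whose components are each uniformly distributed on $(0,1)$. A norm $\|\cdot\|_D$ on $\mathbb{R}^d$ is called a $D$-norm if there exists a random vector $\boldsymbol{Z}=(Z_1,\dots,Z_d)$ with $Z_i\ge 0$ and $E(Z_i)=1$, $1\le i\le d$, such that $\|\boldsymbol{x}\|_D=E\left(\max_{1\le i\le d}|x_i|Z_i\right)$ for all $\boldsymbol{x}\in\mathbb{R}^d$. Here $\|\cdot\|$ is an arbitrary fixed norm on $\mathbb{R}^d$, $\boldsymbol{1}=(1,\dots,1)\in\mathbb{R}^d$, and $\boldsymbol{e}_j$ is the $j$-th unit vector of $\mathbb{R}^d$. For a sample $\boldsymbol{X}^{(j)}=(X_1^{(j)},\dots,X_d^{(j)})$, $j=1,\dots,n$, the ordered values of the $i$-th components $X_i^{(1)},\dots,X_i^{(n)}$ are denoted $X_{1:n,i}\le X_{2:n,i}\le\dots\le X_{n:n,i}$, $1\le i\le d$. The symbol $\to_D$ denotes convergence in distribution, and $N(\boldsymbol{0},\Sigma)$ is the $d$-variate normal distribution with mean $\boldsymbol{0}$ and covariance matrix $\Sigma$. *)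

theory Defs
  imports "HOL-Probability.Probability" "HOL-Library.Landau_Symbols"
begin

definition is_norm :: "('v::real_vector \<Rightarrow> real) \<Rightarrow> bool" where
  "is_norm N \<longleftrightarrow>
     (\<forall>x. 0 \<le> N x) \<and> (\<forall>x. N x = 0 \<longleftrightarrow> x = 0) \<and>
     (\<forall>c x. N (c *\<^sub>R x) = \<bar>c\<bar> * N x) \<and> (\<forall>x y. N (x + y) \<le> N x + N y)"

(* The generating vector Z is represented by its law \<nu> on R^d, so that the existential
   ranges over all random vectors without fixing the type of a sample space. *)
definition is_D_norm :: "(real ^ 'd::finite \<Rightarrow> real) \<Rightarrow> bool" where
  "is_D_norm D \<longleftrightarrow>
     is_norm D \<and>
     (\<exists>\<nu> :: (real ^ 'd) measure.
        prob_space \<nu> \<and> sets \<nu> = sets borel \<and>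
        (AE z in \<nu>. \<forall>i. 0 \<le> z $ i) \<and>
        (\<forall>i. integrable \<nu> (\<lambda>z. z $ i) \<and> (\<integral>z. z $ i \<partial>\<nu>) = 1) \<and>
        (\<forall>x. D x = (\<integral>z. (MAX i\<in>UNIV. \<bar>x $ i\<bar> * z $ i) \<partial>\<nu>)))"

definition joint_cdf :: "(real ^ 'd::finite) measure \<Rightarrow> real ^ 'd \<Rightarrow> real" where
  "joint_cdf \<mu> u = measure \<mu> {x. \<forall>i. x $ i \<le> u $ i}"

(* As for D-norms, the random vector is represented by its law. *)
definition is_copula :: "(real ^ 'd::finite \<Rightarrow> real) \<Rightarrow> bool" where
  "is_copula C \<longleftrightarrow>
     (\<exists>\<mu> :: (real ^ 'd) measure.
        prob_space \<mu> \<and> sets \<mu> = sets borel \<and>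
        (\<forall>i. distr \<mu> borel (\<lambda>x. x $ i) = uniform_measure lborel {0<..<1}) \<and>
        C = joint_cdf \<mu>)"

(* The m-th smallest (1 \<le> m \<le> n) of x 1, ..., x n, i.e. X_{m:n}; ties are kept. *)
definition order_stat :: "nat \<Rightarrow> nat \<Rightarrow> (nat \<Rightarrow> real) \<Rightarrow> real" where
  "order_stat m n x = sort (map x [1..<Suc n]) ! (m - 1)"

(* The law of m + A Z with A A^T = S and Z having independent standard normal components.
   S need not be invertible, so a definition by a Lebesgue density would be too narrow;
   the predicate can only hold if S is symmetric and positive semidefinite. *)
definition is_mv_normal ::
  "(real ^ 'd::finite) measure \<Rightarrow> real ^ 'd \<Rightarrow> real ^ 'd ^ 'd \<Rightarrow> bool" where
  "is_mv_normal \<mu> m S \<longleftrightarrow>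
     (\<exists>A :: real ^ 'd ^ 'd. A ** transpose A = S \<and>
        \<mu> = distr (\<Pi>\<^sub>M i\<in>(UNIV :: 'd set). std_normal_distribution) borel
              (\<lambda>z. m + A *v (\<chi> i. z i)))"

(* Convergence in distribution of Borel laws; the library's weak_conv_m covers only
   laws on the real line. *)
definition weak_conv_borel ::
  "(nat \<Rightarrow> 'a::topological_space measure) \<Rightarrow> 'a measure \<Rightarrow> bool" where
  "weak_conv_borel \<mu>s \<mu> \<longleftrightarrow>
     (\<forall>f :: 'a \<Rightarrow> real. continuous_on UNIV f \<and> bounded (range f) \<longrightarrow>
        (\<lambda>n. \<integral>x. f x \<partial>\<mu>s n) \<longlonglongrightarrow> (\<integral>x. f x \<partial>\<mu>))"

end

theory Submission
  imports Defs
begin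

text \<open>
  The idea is to trade order statistics for counts. The event that the \<open>(n - k)\<close>-th smallest of
  \<open>n\<close> numbers is at most \<open>u\<close> is the event that at most \<open>k\<close> of them exceed \<open>u\<close>. With the threshold
  \<open>u = 1 - p\<close>, where \<open>p = (k - t sqrt k) / n\<close>, this says that the number of exceedances minus \<open>n p\<close>
  (its mean, for uniform observations), divided by \<open>sqrt k\<close>, is at most \<open>t\<close>
  (\<open>normalized_order_stat_le_iff\<close>). Hence the
  joint distribution function at \<open>t\<close> of the normalized vector of order statistics \<^emph>\<open>equals\<close> the joint
  distribution function at \<open>t\<close> of a row sum of a triangular array of bounded, centred,
  independent random vectors, whose entries do depend on \<open>t\<close>.

  For each fixed \<open>t\<close> these row sums satisfy a central limit theorem
  (\<open>multivariate_triangular_clt\<close>). The entries are at most of order \<open>1 / sqrt k\<close>, which tends to 0,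
  so only the limit of the covariances has to be found. The off-diagonal entries are governed by the
  probability that two components are simultaneously large; by inclusion-exclusion and the
  expansion of the copula at \<open>1\<close> this is \<open>p + q - \<parallel>p e\<^sub>i + q e\<^sub>j\<parallel>\<^sub>D\<close> up to
  a negligible error. Multiplied by \<open>n / sqrt (k\<^sub>i k\<^sub>j)\<close>, with \<open>p\<close> and \<open>q\<close> equivalent to
  \<open>k\<^sub>i / n\<close> and \<open>k\<^sub>j / n\<close>, it converges by homogeneity and continuity of the norm
  (\<open>tendsto_joint_tail\<close>, \<open>tail_indicator_covariance\<close>). The limit does not depend on \<open>t\<close>.

  The limiting matrix is a limit of covariance matrices, hence positive semidefinite, and a Cholesky
  factorization (\<open>psd_factorization\<close>) provides the normal law. It may be degenerate, but each
  of its marginals is standard normal, so every \<open>t\<close> is a continuity point of its distribution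
  function.

  Two passages between modes of convergence are needed: from characteristic functions to weak
  convergence in the central limit theorem, and from joint distribution functions to weak convergence
  at the end. Both are instances of one smoothing principle (\<open>weak_conv_borel_if_smoothed\<close>): if
  the densities obtained by smearing the laws with a kernel \<open>K\<close> at every scale converge pointwise,
  then the laws converge weakly. A Gaussian kernel is an average of characters, which gives
  \<open>multivariate_levy_continuity\<close>; the indicator of a cube is an alternating sum of orthants, which
  gives \<open>weak_conv_borel_if_joint_cdf\<close>.
\<close>

section \<open>Weak convergence from smoothed laws\<close>

text \<open>
  Allows a limit to be computed after replacing the sequence and its limit by uniformly close ones:
  used once for smoothing and once for cutting off outside a large ball.
\<close>

lemma LIMSEQ_approx:
  fixes b :: "nat \<Rightarrow> real"
  assumes "\<And>e. e > 0 \<Longrightarrow>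
    \<exists>a l'. a \<longlonglongrightarrow> l' \<and> (\<forall>\<^sub>F n in sequentially. \<bar>b n - a n\<bar> \<le> e) \<and> \<bar>l - l'\<bar> \<le> e"
  shows "b \<longlonglongrightarrow> l"
proof (rule tendstoI)
  fix e :: real assume "e > 0"
  then obtain a l' where a: "a \<longlonglongrightarrow> l'" and ev: "\<forall>\<^sub>F n in sequentially. \<bar>b n - a n\<bar> \<le> e / 4"
    and l: "\<bar>l - l'\<bar> \<le> e / 4"
    using assms[of "e / 4"] by auto
  from a have "\<forall>\<^sub>F n in sequentially. dist (a n) l' < e / 4"
    using \<open>e > 0\<close> by (intro tendstoD) auto
  with ev show "\<forall>\<^sub>F n in sequentially. dist (b n) l < e"
    by eventually_elim (use l \<open>e > 0\<close> in \<open>auto simp: dist_real_def abs_if split: if_splits\<close>)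
qed

text \<open>
  The substitution \<open>x = t + h y\<close>.
\<close>

lemma integral_convolution_rescale:
  fixes f K :: "'a::euclidean_space \<Rightarrow> real"
  assumes h: "h > 0" and [measurable]: "f \<in> borel_measurable borel" "K \<in> borel_measurable borel"
  shows "(\<integral>x. f x * K ((x - t) /\<^sub>R h) \<partial>lborel) = h ^ DIM('a) * (\<integral>y. f (t + h *\<^sub>R y) * K y \<partial>lborel)"
  using h by (subst lborel_affine[of h t])
    (simp_all add: integral_density integral_distr)

text \<open>
  Up to the factor \<open>\<integral>K\<close>, averaging \<open>f\<close> around \<open>t\<close> with the weights \<open>K\<close> at a small scale \<open>h\<close>
  changes \<open>f\<close> little, uniformly in \<open>t\<close>: a large ball carries almost all of the mass of \<open>K\<close>, after
  scaling it becomes small, and \<open>f\<close> is uniformly continuous. Elsewhere boundedness of \<open>f\<close> suffices.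
\<close>

lemma approximate_identity:
  fixes f K :: "'a::euclidean_space \<Rightarrow> real"
  assumes cont: "continuous_on UNIV f" and supp: "\<And>x. R < norm x \<Longrightarrow> f x = 0"
    and K: "integrable lborel K" "\<And>x. 0 \<le> K x" and "e > 0"
  shows "\<exists>h>0. \<forall>t. \<bar>(\<integral>y. f (t + h *\<^sub>R y) * K y \<partial>lborel) - f t * (\<integral>y. K y \<partial>lborel)\<bar> \<le> e"
proof -
  have [measurable]: "f \<in> borel_measurable borel"
    using cont by (rule borel_measurable_continuous_onI)
  note [measurable] = borel_measurable_integrable[OF K(1)]
  have comp: "compact (f ` cball 0 R)"
    by (intro compact_continuous_image continuous_on_subset[OF cont]) auto
  then obtain B0 where "\<forall>y\<in>f ` cball 0 R. norm y \<le> B0"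
    using compact_imp_bounded bounded_iff by metis
  then have B0: "\<bar>f x\<bar> \<le> B0" if "norm x \<le> R" for x using that by auto
  define B where "B = max B0 1"
  have B: "\<bar>f x\<bar> \<le> B" for x
    using B0[of x] supp[of x] by (cases "norm x \<le> R") (auto simp: B_def)
  have "B > 0" by (simp add: B_def)
  define c where "c = (\<integral>y. K y \<partial>lborel) + 1"
  have c: "c \<ge> 1" using K by (auto simp: c_def)
  have "(\<lambda>n. \<integral>y. K y * indicator {y. norm y > real n} y \<partial>lborel) \<longlonglongrightarrow> (\<integral>y. 0 \<partial>(lborel :: 'a measure))"
  proof (rule integral_dominated_convergence[where w=K])
    show "AE x in lborel. (\<lambda>n. K x * indicator {y. norm y > real n} x) \<longlonglongrightarrow> 0"
    proof (rule AE_I2)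
      fix x :: 'a
      obtain m :: nat where "norm x \<le> real m" using real_arch_simple by blast
      then have "\<forall>\<^sub>F n in sequentially. K x * indicator {y. norm y > real n} x = 0"
        by (intro eventually_sequentiallyI[of m]) (auto simp: indicator_def)
      then show "(\<lambda>n. K x * indicator {y. norm y > real n} x) \<longlonglongrightarrow> 0"
        by (rule tendsto_eventually)
    qed
  qed (use K in \<open>auto simp: indicator_def\<close>)
  then have "\<forall>\<^sub>F n in sequentially. (\<integral>y. K y * indicator {y. norm y > real n} y \<partial>lborel) < e / (4 * B)"
    using \<open>B > 0\<close> \<open>e > 0\<close> by (intro order_tendstoD) auto
  then obtain m where m: "(\<integral>y. K y * indicator {y. norm y > real m} y \<partial>lborel) < e / (4 * B)"
    by (meson eventually_happens' sequentially_bot)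
  have "uniformly_continuous_on (cball 0 (R + 2)) f"
    by (intro compact_uniformly_continuous continuous_on_subset[OF cont]) auto
  moreover have "e / (2 * c) > 0" using c \<open>e > 0\<close> by auto
  ultimately obtain d0 where d0: "d0 > 0" 
    "\<And>x y. x \<in> cball 0 (R + 2) \<Longrightarrow> y \<in> cball 0 (R + 2) \<Longrightarrow> dist y x < d0 \<Longrightarrow> dist (f y) (f x) < e / (2 * c)"
    unfolding uniformly_continuous_on_def by metis
  \<comment> \<open>For points at distance below 1, either both lie in the ball of radius \<open>R + 2\<close> or \<open>f\<close> vanishes at both.\<close>
  define d where "d = min d0 1"
  have d: "d > 0" "\<bar>f y - f x\<bar> \<le> e / (2 * c)" if "norm (y - x) < d" for x y
  proof -
    show "d > 0" using d0 by (simp add: d_def)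
    have n: "norm y \<le> norm x + norm (y - x)" "norm x \<le> norm y + norm (y - x)"
      using norm_triangle_sub[of y x] norm_triangle_sub[of x y] by (auto simp: norm_minus_commute)
    show "\<bar>f y - f x\<bar> \<le> e / (2 * c)"
    proof (cases "norm x \<le> R + 1")
      case True
      then show ?thesis using d0(2)[of x y] that n by (auto simp: d_def dist_norm norm_minus_commute)
    next
      case False
      then have "f x = 0" "f y = 0" using n that by (auto intro!: supp simp: d_def)
      then show ?thesis using \<open>e / (2 * c) > 0\<close> by simp
    qed
  qed
  have "d > 0" using d0 by (simp add: d_def)
  \<comment> \<open>The ball of radius \<open>m\<close>, which carries most of the mass of \<open>K\<close>, is scaled into the ball of radius \<open>d\<close>.\<close>
  define h where "h = d / (real m + 1)"
  have "h > 0" using \<open>d > 0\<close> by (simp add: h_def)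
  have "\<bar>(\<integral>y. f (t + h *\<^sub>R y) * K y \<partial>lborel) - f t * (\<integral>y. K y \<partial>lborel)\<bar> \<le> e" for t
  proof -
    have int: "integrable lborel (\<lambda>y. f (t + h *\<^sub>R y) * K y)"
      by (rule Bochner_Integration.integrable_bound[where f="\<lambda>y. B * K y"])
         (use K B \<open>B > 0\<close> in \<open>auto simp: abs_mult intro!: mult_right_mono\<close>)
    have intI: "integrable lborel (\<lambda>y. K y * indicator {y. norm y > real m} y)"
      by (rule Bochner_Integration.integrable_bound[where f=K]) (use K in \<open>auto simp: indicator_def\<close>)
    have "(\<integral>y. f (t + h *\<^sub>R y) * K y \<partial>lborel) - f t * (\<integral>y. K y \<partial>lborel)
        = (\<integral>y. (f (t + h *\<^sub>R y) - f t) * K y \<partial>lborel)"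
      using int K(1) by (simp add: left_diff_distrib)
    also have "\<bar>\<dots>\<bar> \<le> (\<integral>y. e / (2 * c) * K y + 2 * B * (K y * indicator {y. norm y > real m} y) \<partial>lborel)"
    proof (rule integral_abs_bound[THEN order_trans], rule integral_mono)
      show "integrable lborel (\<lambda>y. \<bar>(f (t + h *\<^sub>R y) - f t) * K y\<bar>)"
        using int K(1) by (simp add: left_diff_distrib)
      show "integrable lborel (\<lambda>y. e / (2 * c) * K y + 2 * B * (K y * indicator {y. norm y > real m} y))"
        using intI K(1) by simp
      fix y :: 'a
      show "\<bar>(f (t + h *\<^sub>R y) - f t) * K y\<bar> \<le> e / (2 * c) * K y + 2 * B * (K y * indicator {y. norm y > real m} y)"
      proof (cases "norm y \<le> real m")
        case True
        then have "h * norm y < d"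
          using \<open>d > 0\<close> by (simp add: h_def field_simps) (smt (verit) mult_left_mono)
        then have "\<bar>f (t + h *\<^sub>R y) - f t\<bar> \<le> e / (2 * c)"
          using \<open>h > 0\<close> by (intro d) auto
        then have "\<bar>f (t + h *\<^sub>R y) - f t\<bar> * K y \<le> e / (2 * c) * K y" by (rule mult_right_mono) (rule K)
        then show ?thesis using True K(2)[of y] by (simp add: abs_mult)
      next
        case False
        have "\<bar>f (t + h *\<^sub>R y) - f t\<bar> \<le> 2 * B" using B[of t] B[of "t + h *\<^sub>R y"] by linarith
        then have "\<bar>f (t + h *\<^sub>R y) - f t\<bar> * K y \<le> 2 * B * K y" by (rule mult_right_mono) (rule K)
        moreover have "0 \<le> e / (2 * c) * K y"
          using \<open>e / (2 * c) > 0\<close> K(2)[of y] by (intro mult_nonneg_nonneg) auto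
        ultimately show ?thesis using False K(2)[of y] by (simp add: abs_mult)
      qed
    qed
    also have "\<dots> = e / (2 * c) * (\<integral>y. K y \<partial>lborel) + 2 * B * (\<integral>y. K y * indicator {y. norm y > real m} y \<partial>lborel)"
      using intI K(1) by simp
    also have "\<dots> \<le> e / (2 * c) * c + 2 * B * (e / (4 * B))"
      using m c \<open>B > 0\<close> \<open>e > 0\<close> by (intro add_mono mult_left_mono) (auto simp: c_def)
    also have "\<dots> = e" using c \<open>B > 0\<close> by simp
    finally show ?thesis .
  qed
  with \<open>h > 0\<close> show ?thesis by blast
qed

lemma integral_swap_convolution:
  fixes f K :: "'a::euclidean_space \<Rightarrow> real"
  assumes M: "prob_space M" "sets M = sets borel" and f: "integrable lborel f"
    and [measurable]: "K \<in> borel_measurable borel" and K: "\<And>x. \<bar>K x\<bar> \<le> B"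
  shows "(\<integral>x. f x * (\<integral>t. K ((x - t) /\<^sub>R h) \<partial>M) \<partial>lborel)
       = (\<integral>t. (\<integral>x. f x * K ((x - t) /\<^sub>R h) \<partial>lborel) \<partial>M)"
proof -
  note [measurable] = borel_measurable_integrable[OF f]
  note [measurable_cong] = M(2)
  interpret M: prob_space M by fact
  interpret pair_sigma_finite lborel M ..
  have "integrable (lborel \<Otimes>\<^sub>M M) (\<lambda>(x, t). f x)"
    by (rule Fubini_integrable) (use f in \<open>auto simp: M.prob_space\<close>)
  then have "integrable (lborel \<Otimes>\<^sub>M M) (\<lambda>z. B * (case z of (x, t) \<Rightarrow> f x))" by simp
  then have "integrable (lborel \<Otimes>\<^sub>M M) (\<lambda>(x, t). f x * K ((x - t) /\<^sub>R h))"
  proof (rule Bochner_Integration.integrable_bound)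
    have "\<bar>f x\<bar> * \<bar>K y\<bar> \<le> \<bar>B\<bar> * \<bar>f x\<bar>" for x y
      using mult_left_mono[of "\<bar>K y\<bar>" "\<bar>B\<bar>" "\<bar>f x\<bar>"] K[of y] by (simp add: mult.commute)
    then show "AE z in lborel \<Otimes>\<^sub>M M. norm (case z of (x, t) \<Rightarrow> f x * K ((x - t) /\<^sub>R h))
        \<le> norm (B * (case z of (x, t) \<Rightarrow> f x))"
      by (auto simp: abs_mult)
  qed measurable
  from Fubini_integral[OF this] show ?thesis by simp
qed

text \<open>
  By Fubini, the integral of a smoothed \<open>f\<close> against a law is the Lebesgue integral of \<open>f\<close>
  against the smoothed law, up to a constant. The latter converges by dominated convergence, and the former is
  uniformly close to the integral of \<open>f\<close> itself.
\<close>

lemma weak_conv_test_compact_support: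
  fixes \<mu>s :: "nat \<Rightarrow> 'a::euclidean_space measure" and K :: "'a \<Rightarrow> real"
  assumes \<mu>s: "\<And>n. prob_space (\<mu>s n)" "\<And>n. sets (\<mu>s n) = sets borel"
    and \<mu>: "prob_space \<mu>" "sets \<mu> = sets borel"
    and K: "integrable lborel K" "\<And>x. 0 \<le> K x" "\<And>x. K x \<le> B" "0 < (\<integral>x. K x \<partial>lborel)"
    and conv: "\<And>h x. h > 0 \<Longrightarrow>
      (\<lambda>n. \<integral>t. K ((x - t) /\<^sub>R h) \<partial>\<mu>s n) \<longlonglongrightarrow> (\<integral>t. K ((x - t) /\<^sub>R h) \<partial>\<mu>)"
    and f: "continuous_on UNIV f" "\<And>x. R < norm x \<Longrightarrow> f x = (0::real)"
  shows "(\<lambda>n. \<integral>x. f x \<partial>\<mu>s n) \<longlonglongrightarrow> (\<integral>x. f x \<partial>\<mu>)"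
proof (rule LIMSEQ_approx)
  fix e :: real assume "e > 0"
  define c where "c = (\<integral>y. K y \<partial>lborel)"
  have "c > 0" using K by (simp add: c_def)
  have absK: "\<bar>K x\<bar> \<le> B" for x using K(2,3)[of x] by simp
  note [measurable] = borel_measurable_integrable[OF K(1)]
  have [measurable]: "f \<in> borel_measurable borel"
    using f(1) by (rule borel_measurable_continuous_onI)
  have comp: "compact (f ` cball 0 R)"
    by (intro compact_continuous_image continuous_on_subset[OF f(1)]) auto
  then obtain Bf where "\<forall>y\<in>f ` cball 0 R. norm y \<le> Bf"
    using compact_imp_bounded bounded_iff by metis
  then have Bf: "\<bar>f x\<bar> \<le> Bf" if "norm x \<le> R" for x using that by auto
  have Bf: "\<bar>f x\<bar> \<le> max Bf 0" for x
    using Bf[of x] f(2)[of x] by (cases "norm x \<le> R") auto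
  have intf: "integrable lborel f"
  proof (rule Bochner_Integration.integrable_bound)
    show "integrable lborel (\<lambda>x::'a. max Bf 0 * indicator (cball 0 R) x)"
      using emeasure_lborel_cball_finite[of "0::'a" R]
      by (intro integrable_mult_right integrable_real_indicator) auto
    show "AE x in lborel. norm (f x) \<le> norm (max Bf 0 * indicator (cball 0 R) x)"
      using Bf f(2) by (auto simp: indicator_def)
  qed measurable
  obtain h where "h > 0" and h: "\<And>t. \<bar>(\<integral>y. f (t + h *\<^sub>R y) * K y \<partial>lborel) - f t * c\<bar> \<le> e * c"
    using approximate_identity[OF f K(1,2), where e="e * c"] \<open>e > 0\<close> \<open>c > 0\<close> by (auto simp: c_def)
  define G where "G \<rho> = (\<integral>x. f x * (\<integral>t. K ((x - t) /\<^sub>R h) \<partial>\<rho>) \<partial>lborel) / (h ^ DIM('a) * c)" for \<rho>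
  have approx: "\<bar>(\<integral>x. f x \<partial>\<rho>) - G \<rho>\<bar> \<le> e" if \<rho>: "prob_space \<rho>" "sets \<rho> = sets borel" for \<rho>
  proof -
    interpret prob_space \<rho> by fact
    note [measurable_cong] = \<rho>(2)
    have 1: "G \<rho> = (\<integral>t. (\<integral>y. f (t + h *\<^sub>R y) * K y \<partial>lborel) / c \<partial>\<rho>)"
      unfolding G_def
      using \<open>h > 0\<close> \<open>c > 0\<close>
      by (subst integral_swap_convolution[OF \<rho> intf _ absK])
         (simp_all add: integral_convolution_rescale[OF \<open>h > 0\<close>, of f K])
    have d: "\<bar>(\<integral>y. f (t + h *\<^sub>R y) * K y \<partial>lborel) / c - f t\<bar> \<le> e" for t
      using h[of t] \<open>c > 0\<close> by (simp add: abs_le_iff field_simps)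
    have i1: "integrable \<rho> f"
      using Bf by (intro integrable_const_bound[where B="max Bf 0"]) auto
    have i2: "integrable \<rho> (\<lambda>t. (\<integral>y. f (t + h *\<^sub>R y) * K y \<partial>lborel) / c)"
    proof (rule integrable_const_bound[where B="max Bf 0 + e"])
      show "AE t in \<rho>. norm ((\<integral>y. f (t + h *\<^sub>R y) * K y \<partial>lborel) / c) \<le> max Bf 0 + e"
        using d Bf by (intro AE_I2) (smt (verit, best) real_norm_def)
    qed measurable
    have "(\<integral>x. f x \<partial>\<rho>) - G \<rho> = (\<integral>t. f t - (\<integral>y. f (t + h *\<^sub>R y) * K y \<partial>lborel) / c \<partial>\<rho>)"
      unfolding 1 using i1 i2 by (intro Bochner_Integration.integral_diff[symmetric])
    also have "\<bar>\<dots>\<bar> \<le> (\<integral>t. e \<partial>\<rho>)"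
    proof (rule integral_abs_bound[THEN order_trans], rule integral_mono)
      show "\<bar>f t - (\<integral>y. f (t + h *\<^sub>R y) * K y \<partial>lborel) / c\<bar> \<le> e" for t
        using d[of t] by linarith
    qed (use i1 i2 in auto)
    finally show ?thesis by (simp add: prob_space)
  qed
  have "(\<lambda>n. \<integral>x. f x * (\<integral>t. K ((x - t) /\<^sub>R h) \<partial>\<mu>s n) \<partial>lborel)
      \<longlonglongrightarrow> (\<integral>x. f x * (\<integral>t. K ((x - t) /\<^sub>R h) \<partial>\<mu>) \<partial>lborel)"
  proof (rule integral_dominated_convergence[where w="\<lambda>x. \<bar>f x\<bar> * B"])
    show "integrable lborel (\<lambda>x. \<bar>f x\<bar> * B)" using intf by simp
    show "AE x in lborel. (\<lambda>n. f x * (\<integral>t. K ((x - t) /\<^sub>R h) \<partial>\<mu>s n)) \<longlonglongrightarrow> f x * (\<integral>t. K ((x - t) /\<^sub>R h) \<partial>\<mu>)"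
      using conv \<open>h > 0\<close> by (intro AE_I2 tendsto_mult tendsto_const)
    have meas: "(\<lambda>x. f x * (\<integral>t. K ((x - t) /\<^sub>R h) \<partial>\<rho>)) \<in> borel_measurable lborel"
      if \<rho>: "prob_space \<rho>" "sets \<rho> = sets borel" for \<rho>
    proof -
      interpret prob_space \<rho> by fact
      note [measurable_cong] = \<rho>(2)
      show ?thesis by measurable
    qed
    show "(\<lambda>x. f x * (\<integral>t. K ((x - t) /\<^sub>R h) \<partial>\<mu>)) \<in> borel_measurable lborel"
      by (rule meas) fact+
    show "(\<lambda>x. f x * (\<integral>t. K ((x - t) /\<^sub>R h) \<partial>\<mu>s n)) \<in> borel_measurable lborel" for n
      by (rule meas) fact+
    show "AE x in lborel. norm (f x * (\<integral>t. K ((x - t) /\<^sub>R h) \<partial>\<mu>s n)) \<le> \<bar>f x\<bar> * B" for n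
    proof (rule AE_I2)
      fix x
      interpret prob_space "\<mu>s n" by (rule \<mu>s)
      note [measurable_cong] = \<mu>s(2)
      have "(\<integral>t. K ((x - t) /\<^sub>R h) \<partial>\<mu>s n) \<le> B"
        by (rule integral_le_const) (use K in \<open>auto intro!: integrable_const_bound[where B=B]\<close>)
      moreover have "0 \<le> (\<integral>t. K ((x - t) /\<^sub>R h) \<partial>\<mu>s n)" using K by auto
      ultimately show "norm (f x * (\<integral>t. K ((x - t) /\<^sub>R h) \<partial>\<mu>s n)) \<le> \<bar>f x\<bar> * B"
        by (simp add: abs_mult mult_left_mono)
    qed
  qed
  then have "(\<lambda>n. G (\<mu>s n)) \<longlonglongrightarrow> G \<mu>"
    unfolding G_def using \<open>h > 0\<close> \<open>c > 0\<close> by (intro tendsto_divide) auto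
  then show "\<exists>a l'. a \<longlonglongrightarrow> l' \<and> (\<forall>\<^sub>F n in sequentially. \<bar>(\<integral>x. f x \<partial>\<mu>s n) - a n\<bar> \<le> e) \<and> \<bar>(\<integral>x. f x \<partial>\<mu>) - l'\<bar> \<le> e"
    using approx[OF \<mu>s] approx[OF \<mu>] by (intro exI[of _ "\<lambda>n. G (\<mu>s n)"] exI[of _ "G \<mu>"] conjI) auto
qed

text \<open>
  Tightness comes for free: since the limit is a probability measure, some compactly supported
  cutoff function between 0 and 1 has integral almost 1 under it. By convergence its integrals under
  the laws of the sequence are almost 1 eventually, so no mass escapes to infinity.
\<close>

lemma weak_conv_borel_if_compact_support:
  fixes \<mu>s :: "nat \<Rightarrow> 'a::euclidean_space measure"
  assumes \<mu>s: "\<And>n. prob_space (\<mu>s n)" "\<And>n. sets (\<mu>s n) = sets borel"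
    and \<mu>: "prob_space \<mu>" "sets \<mu> = sets borel"
    and conv: "\<And>f R. continuous_on UNIV f \<Longrightarrow> (\<And>x. R < norm x \<Longrightarrow> f x = (0::real)) \<Longrightarrow>
      (\<lambda>n. \<integral>x. f x \<partial>\<mu>s n) \<longlonglongrightarrow> (\<integral>x. f x \<partial>\<mu>)"
  shows "weak_conv_borel \<mu>s \<mu>"
  unfolding weak_conv_borel_def
proof safe
  fix f :: "'a \<Rightarrow> real"
  assume f: "continuous_on UNIV f" and "bounded (range f)"
  then obtain B0 where B0: "\<And>x. \<bar>f x\<bar> \<le> B0" by (auto simp: bounded_iff)
  define B where "B = max B0 1"
  have B: "\<bar>f x\<bar> \<le> B" "B > 0" for x using B0[of x] by (auto simp: B_def)
  have [measurable]: "f \<in> borel_measurable borel"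
    using f by (rule borel_measurable_continuous_onI)
  define g :: "nat \<Rightarrow> 'a \<Rightarrow> real" where "g m x = max 0 (min 1 (real m + 1 - norm x))" for m x
  have gc: "continuous_on UNIV (g m)" for m unfolding g_def by (intro continuous_intros)
  have [measurable]: "g m \<in> borel_measurable borel" for m
    using gc by (rule borel_measurable_continuous_onI)
  have g01: "0 \<le> g m x" "g m x \<le> 1" "real m + 1 < norm x \<Longrightarrow> g m x = 0" for m x
    by (auto simp: g_def)
  have lim1: "(\<lambda>m. \<integral>x. g m x \<partial>\<mu>) \<longlonglongrightarrow> (\<integral>x. (1::real) \<partial>\<mu>)"
  proof (rule integral_dominated_convergence[where w="\<lambda>_. 1"])
    interpret prob_space \<mu> by fact
    note [measurable_cong] = \<mu>(2)
    show "g m \<in> borel_measurable \<mu>" for m by measurable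
    show "AE x in \<mu>. (\<lambda>m. g m x) \<longlonglongrightarrow> 1"
    proof (rule AE_I2)
      fix x :: 'a
      obtain m :: nat where "norm x \<le> real m" using real_arch_simple by blast
      then have "\<forall>\<^sub>F n in sequentially. g n x = 1"
        by (intro eventually_sequentiallyI[of m]) (auto simp: g_def)
      then show "(\<lambda>m. g m x) \<longlonglongrightarrow> 1" by (rule tendsto_eventually)
    qed
    show "integrable \<mu> (\<lambda>x. 1::real)" by simp
  qed (use g01 in auto)
  show "(\<lambda>n. \<integral>x. f x \<partial>\<mu>s n) \<longlonglongrightarrow> (\<integral>x. f x \<partial>\<mu>)"
  proof (rule LIMSEQ_approx)
    fix e :: real assume "e > 0"
    have "(\<integral>x. 1 \<partial>\<mu>) = (1::real)" using prob_space.prob_space[OF \<mu>(1)] by simp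
    then have "\<forall>\<^sub>F m in sequentially. (\<integral>x. g m x \<partial>\<mu>) > 1 - e / B"
      using \<open>B > 0\<close> \<open>e > 0\<close> by (intro order_tendstoD[OF lim1]) auto
    then obtain m where m: "(\<integral>x. g m x \<partial>\<mu>) > 1 - e / B"
      by (meson eventually_happens' sequentially_bot)
    have "(\<lambda>n. \<integral>x. g m x \<partial>\<mu>s n) \<longlonglongrightarrow> (\<integral>x. g m x \<partial>\<mu>)"
      using gc g01(3) by (rule conv)
    then have ev: "\<forall>\<^sub>F n in sequentially. (\<integral>x. g m x \<partial>\<mu>s n) > 1 - e / B"
      using m by (rule order_tendstoD)
    have approx: "\<bar>(\<integral>x. f x \<partial>\<rho>) - (\<integral>x. f x * g m x \<partial>\<rho>)\<bar> \<le> e"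
      if \<rho>: "prob_space \<rho>" "sets \<rho> = sets borel" and *: "(\<integral>x. g m x \<partial>\<rho>) > 1 - e / B" for \<rho>
    proof -
      interpret prob_space \<rho> by fact
      note [measurable_cong] = \<rho>(2)
      have "\<bar>f x\<bar> * g m x \<le> B * 1" for x
        using B(1)[of x] B(2) g01(1,2)[of m x] by (intro mult_mono) auto
      then have i: "integrable \<rho> f" "integrable \<rho> (\<lambda>x. f x * g m x)"
        using B g01 by (auto intro!: integrable_const_bound[where B=B] simp: abs_mult)
      have ig: "integrable \<rho> (g m)"
        using g01 by (intro integrable_const_bound[where B=1]) auto
      note i = i ig
      have "(\<integral>x. f x \<partial>\<rho>) - (\<integral>x. f x * g m x \<partial>\<rho>) = (\<integral>x. f x * (1 - g m x) \<partial>\<rho>)"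
        using i by (simp add: right_diff_distrib)
      also have "\<bar>\<dots>\<bar> \<le> (\<integral>x. B * (1 - g m x) \<partial>\<rho>)"
      proof (rule integral_abs_bound[THEN order_trans], rule integral_mono)
        show "\<bar>f x * (1 - g m x)\<bar> \<le> B * (1 - g m x)" for x
          using B(1)[of x] g01(2)[of m x] by (auto simp: abs_mult intro!: mult_right_mono)
      qed (use i in \<open>auto simp: right_diff_distrib\<close>)
      also have "\<dots> = B * (1 - (\<integral>x. g m x \<partial>\<rho>))"
        using i by (simp add: prob_space)
      also have "\<dots> \<le> e" using * \<open>B > 0\<close> by (simp add: field_simps)
      finally show ?thesis .
    qed
    have "(\<lambda>n. \<integral>x. f x * g m x \<partial>\<mu>s n) \<longlonglongrightarrow> (\<integral>x. f x * g m x \<partial>\<mu>)"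
      using f gc g01(3)[of m] by (intro conv[where R="real m + 1"] continuous_intros) auto
    moreover have "\<forall>\<^sub>F n in sequentially. \<bar>(\<integral>x. f x \<partial>\<mu>s n) - (\<integral>x. f x * g m x \<partial>\<mu>s n)\<bar> \<le> e"
      using ev by eventually_elim (rule approx[OF \<mu>s])
    ultimately show "\<exists>a l'. a \<longlonglongrightarrow> l' \<and> (\<forall>\<^sub>F n in sequentially. \<bar>(\<integral>x. f x \<partial>\<mu>s n) - a n\<bar> \<le> e)
        \<and> \<bar>(\<integral>x. f x \<partial>\<mu>) - l'\<bar> \<le> e"
      using approx[OF \<mu> m] by blast
  qed
qed

text \<open>
  The common source of the two criteria for weak convergence below. The scale \<open>h\<close> is arbitrary
  because the error of smoothing is removed by choosing it small.
\<close>

lemma weak_conv_borel_if_smoothed: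
  fixes \<mu>s :: "nat \<Rightarrow> 'a::euclidean_space measure" and K :: "'a \<Rightarrow> real"
  assumes \<mu>s: "\<And>n. prob_space (\<mu>s n)" "\<And>n. sets (\<mu>s n) = sets borel"
    and \<mu>: "prob_space \<mu>" "sets \<mu> = sets borel"
    and K: "integrable lborel K" "\<And>x. 0 \<le> K x" "\<And>x. K x \<le> B" "0 < (\<integral>x. K x \<partial>lborel)"
    and conv: "\<And>h x. h > 0 \<Longrightarrow>
      (\<lambda>n. \<integral>t. K ((x - t) /\<^sub>R h) \<partial>\<mu>s n) \<longlonglongrightarrow> (\<integral>t. K ((x - t) /\<^sub>R h) \<partial>\<mu>)"
  shows "weak_conv_borel \<mu>s \<mu>"
proof (rule weak_conv_borel_if_compact_support[OF \<mu>s \<mu>])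
  fix f :: "'a \<Rightarrow> real" and R
  assume f: "continuous_on UNIV f" "\<And>x. R < norm x \<Longrightarrow> f x = 0"
  show "(\<lambda>n. \<integral>x. f x \<partial>\<mu>s n) \<longlonglongrightarrow> (\<integral>x. f x \<partial>\<mu>)"
    by (rule weak_conv_test_compact_support[OF \<mu>s \<mu> K, OF conv f])
qed

section \<open>Characteristic functions determine weak limits\<close>

text \<open>
  By independence the integral factors into one-dimensional characteristic functions.
\<close>

lemma integral_iexp_PiM_std_normal:
  assumes "finite I"
  shows "(\<integral>z. iexp (\<Sum>i\<in>I. c i * z i) \<partial>(\<Pi>\<^sub>M i\<in>I. std_normal_distribution))
       = complex_of_real (exp (- (\<Sum>i\<in>I. (c i)\<^sup>2) / 2))"
proof -
  interpret N: real_distribution std_normal_distribution by (rule real_dist_normal_dist)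
  interpret product_prob_space "\<lambda>_. std_normal_distribution" by unfold_locales
  have "(\<integral>z. iexp (\<Sum>i\<in>I. c i * z i) \<partial>(\<Pi>\<^sub>M i\<in>I. std_normal_distribution))
      = (\<integral>z. (\<Prod>i\<in>I. iexp (c i * z i)) \<partial>(\<Pi>\<^sub>M i\<in>I. std_normal_distribution))"
    using assms by (simp add: exp_sum sum_distrib_left)
  also have "\<dots> = (\<Prod>i\<in>I. \<integral>x. iexp (c i * x) \<partial>std_normal_distribution)"
    using assms by (intro product_integral_prod N.integrable_iexp) auto
  also have "\<dots> = (\<Prod>i\<in>I. complex_of_real (exp (- ((c i)\<^sup>2) / 2)))"
    using fun_cong[OF char_std_normal_distribution] unfolding char_def by simp
  also have "\<dots> = complex_of_real (exp (- (\<Sum>i\<in>I. (c i)\<^sup>2) / 2))"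
    using assms by (simp add: exp_sum[symmetric] sum_negf sum_divide_distrib flip: of_real_prod)
  finally show ?thesis .
qed

text \<open>
  The Gaussian kernel is itself the characteristic function of a standard normal vector. Exchanging
  the two integrations therefore writes a law smoothed by it as an average of its characteristic
  function. The standard normal vector has its coordinates indexed by the basis, and \<open>w\<close> turns them into an
  element of the space.
\<close>

lemma integral_gaussian_kernel:
  fixes \<rho> :: "'a::euclidean_space measure"
  defines "P \<equiv> \<Pi>\<^sub>M b\<in>(Basis :: 'a set). std_normal_distribution"
    and "w \<equiv> \<lambda>z. \<Sum>b\<in>(Basis :: 'a set). z b *\<^sub>R b"
  assumes \<rho>: "prob_space \<rho>" "sets \<rho> = sets borel"
  shows "complex_of_real (\<integral>t. exp (- (norm ((x - t) /\<^sub>R h))\<^sup>2 / 2) \<partial>\<rho>)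
       = (\<integral>z. iexp (w z \<bullet> x / h) * (\<integral>t. iexp ((- w z /\<^sub>R h) \<bullet> t) \<partial>\<rho>) \<partial>P)"
    and "(\<lambda>z. iexp (w z \<bullet> x / h) * (\<integral>t. iexp ((- w z /\<^sub>R h) \<bullet> t) \<partial>\<rho>)) \<in> borel_measurable P"
proof -
  interpret \<rho>: prob_space \<rho> by fact
  interpret N: real_distribution std_normal_distribution by (rule real_dist_normal_dist)
  interpret PP: prob_space P unfolding P_def by (rule prob_space_PiM) (rule N.prob_space_axioms)
  interpret pair_prob_space P \<rho> ..
  note [measurable_cong] = \<rho>(2)
  have [measurable]: "w \<in> borel_measurable P" unfolding w_def P_def by measurable
  show "(\<lambda>z. iexp (w z \<bullet> x / h) * (\<integral>t. iexp ((- w z /\<^sub>R h) \<bullet> t) \<partial>\<rho>)) \<in> borel_measurable P"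
    by measurable
  have 1: "complex_of_real (exp (- (norm ((x - t) /\<^sub>R h))\<^sup>2 / 2)) = (\<integral>z. iexp (w z \<bullet> x / h) * iexp ((- w z /\<^sub>R h) \<bullet> t) \<partial>P)" for t
  proof -
    have "complex_of_real (exp (- (norm ((x - t) /\<^sub>R h))\<^sup>2 / 2))
      = complex_of_real (exp (- (\<Sum>b\<in>Basis. (((x - t) /\<^sub>R h) \<bullet> b)\<^sup>2) / 2))"
      unfolding power2_norm_eq_inner by (subst euclidean_inner) (simp add: power2_eq_square)
    also have "\<dots> = (\<integral>z. iexp (\<Sum>b\<in>Basis. (((x - t) /\<^sub>R h) \<bullet> b) * z b) \<partial>P)"
      unfolding P_def by (rule integral_iexp_PiM_std_normal[symmetric]) simp
    also have "\<dots> = (\<integral>z. iexp (w z \<bullet> x / h) * iexp ((- w z /\<^sub>R h) \<bullet> t) \<partial>P)"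
    proof (intro Bochner_Integration.integral_cong refl)
      fix z
      have "(\<Sum>b\<in>Basis. (((x - t) /\<^sub>R h) \<bullet> b) * z b) = w z \<bullet> ((x - t) /\<^sub>R h)"
        unfolding w_def inner_sum_left by (simp add: inner_commute sum_distrib_left mult_ac)
      also have "\<dots> = w z \<bullet> x / h + (- w z /\<^sub>R h) \<bullet> t"
        by (simp add: inner_diff_right divide_inverse algebra_simps)
      finally show "iexp (\<Sum>b\<in>Basis. (((x - t) /\<^sub>R h) \<bullet> b) * z b) = iexp (w z \<bullet> x / h) * iexp ((- w z /\<^sub>R h) \<bullet> t)"
        by (simp only: of_real_add distrib_left exp_add)
    qed
    finally show ?thesis .
  qed
  have int: "integrable (P \<Otimes>\<^sub>M \<rho>) (\<lambda>(z, t). iexp (w z \<bullet> x / h) * iexp ((- w z /\<^sub>R h) \<bullet> t))"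
    by (rule integrable_const_bound[where B=1]) (auto simp: norm_mult)
  have "complex_of_real (\<integral>t. exp (- (norm ((x - t) /\<^sub>R h))\<^sup>2 / 2) \<partial>\<rho>)
      = (\<integral>t. (\<integral>z. iexp (w z \<bullet> x / h) * iexp ((- w z /\<^sub>R h) \<bullet> t) \<partial>P) \<partial>\<rho>)"
    by (simp only: 1 flip: integral_complex_of_real)
  also have "\<dots> = (\<integral>z. (\<integral>t. iexp (w z \<bullet> x / h) * iexp ((- w z /\<^sub>R h) \<bullet> t) \<partial>\<rho>) \<partial>P)"
    by (rule Fubini_integral[OF int])
  finally show "complex_of_real (\<integral>t. exp (- (norm ((x - t) /\<^sub>R h))\<^sup>2 / 2) \<partial>\<rho>)
       = (\<integral>z. iexp (w z \<bullet> x / h) * (\<integral>t. iexp ((- w z /\<^sub>R h) \<bullet> t) \<partial>\<rho>) \<partial>P)"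
    by simp
qed

text \<open>
  The Gaussian splits into a product over the coordinates.
\<close>

lemma integrable_gaussian_kernel:
  "integrable lborel (\<lambda>x::'a::euclidean_space. exp (- (norm x)\<^sup>2 / 2))"
proof -
  have "exp (- (norm x)\<^sup>2 / 2) = (\<Prod>b\<in>Basis. exp (- (x \<bullet> b)\<^sup>2 / 2))" for x :: 'a
    unfolding power2_norm_eq_inner
    by (subst euclidean_inner) (simp add: power2_eq_square exp_sum[symmetric] sum_negf sum_divide_distrib)
  then have "(\<integral>\<^sup>+x. ennreal (norm (exp (- (norm (x::'a))\<^sup>2 / 2))) \<partial>lborel)
      = (\<integral>\<^sup>+x. (\<Prod>b\<in>Basis. ennreal (exp (- ((x::'a) \<bullet> b)\<^sup>2 / 2))) \<partial>lborel)"
    by (simp add: prod_ennreal abs_prod)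
  also have "\<dots> = (\<Prod>b\<in>(Basis::'a set). \<integral>\<^sup>+x. ennreal (exp (- x\<^sup>2 / 2)) \<partial>lborel)"
    by (rule nn_integral_lborel_prod) auto
  also have "(\<integral>\<^sup>+x. ennreal (exp (- x\<^sup>2 / 2)) \<partial>lborel) = ennreal (sqrt (2 * pi)) * (\<integral>\<^sup>+x. ennreal (std_normal_density x) \<partial>lborel)"
    by (subst nn_integral_cmult[symmetric]) (auto simp: std_normal_density_def ennreal_mult[symmetric])
  also have "(\<integral>\<^sup>+x. ennreal (std_normal_density x) \<partial>lborel) = 1"
    using prob_space.emeasure_space_1[OF prob_space_normal_density[of 1 0]]
    by (simp add: emeasure_density)
  finally have "(\<integral>\<^sup>+x. ennreal (norm (exp (- (norm (x::'a))\<^sup>2 / 2))) \<partial>lborel) = ennreal (sqrt (2 * pi)) ^ DIM('a)"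
    by simp
  also have "\<dots> < \<infinity>" by (simp add: ennreal_power)
  finally show ?thesis by (intro integrableI_bounded) auto
qed

text \<open>
  Smoothing with a Gaussian expresses the smoothed laws through characteristic functions, which are bounded by 1,
  so pointwise convergence is inherited by dominated convergence.
\<close>

lemma multivariate_levy_continuity:
  fixes \<mu>s :: "nat \<Rightarrow> 'a::euclidean_space measure"
  assumes \<mu>s: "\<And>n. prob_space (\<mu>s n)" "\<And>n. sets (\<mu>s n) = sets borel"
    and \<mu>: "prob_space \<mu>" "sets \<mu> = sets borel"
    and conv: "\<And>s. (\<lambda>n. \<integral>x. iexp (s \<bullet> x) \<partial>\<mu>s n) \<longlonglongrightarrow> (\<integral>x. iexp (s \<bullet> x) \<partial>\<mu>)"
  shows "weak_conv_borel \<mu>s \<mu>"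
proof (rule weak_conv_borel_if_smoothed[OF \<mu>s \<mu>, where B=1])
  show "integrable lborel (\<lambda>x::'a. exp (- (norm x)\<^sup>2 / 2))" by (rule integrable_gaussian_kernel)
  show "0 < (\<integral>x. exp (- (norm (x::'a))\<^sup>2 / 2) \<partial>lborel)"
  proof -
    have "(\<integral>x. exp (- (norm (x::'a))\<^sup>2 / 2) \<partial>lborel) \<noteq> 0"
      by (subst integral_nonneg_eq_0_iff_AE[OF integrable_gaussian_kernel])
        (auto simp: eventually_False ae_filter_eq_bot_iff)
    moreover have "0 \<le> (\<integral>x. exp (- (norm (x::'a))\<^sup>2 / 2) \<partial>lborel)" by simp
    ultimately show ?thesis by linarith
  qed
  fix h :: real and x :: 'a assume "h > 0"
  let ?P = "\<Pi>\<^sub>M b\<in>(Basis :: 'a set). std_normal_distribution"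
  let ?w = "\<lambda>z. \<Sum>b\<in>(Basis :: 'a set). z b *\<^sub>R b"
  interpret N: real_distribution std_normal_distribution by (rule real_dist_normal_dist)
  interpret product_prob_space "\<lambda>_. std_normal_distribution" "Basis :: 'a set" by unfold_locales
  have "(\<lambda>n. \<integral>z. iexp (?w z \<bullet> x / h) * (\<integral>t. iexp ((- ?w z /\<^sub>R h) \<bullet> t) \<partial>\<mu>s n) \<partial>?P)
      \<longlonglongrightarrow> (\<integral>z. iexp (?w z \<bullet> x / h) * (\<integral>t. iexp ((- ?w z /\<^sub>R h) \<bullet> t) \<partial>\<mu>) \<partial>?P)"
  proof (rule integral_dominated_convergence[where w="\<lambda>_. 1"])
    show "AE z in ?P. norm (iexp (?w z \<bullet> x / h) * (\<integral>t. iexp ((- ?w z /\<^sub>R h) \<bullet> t) \<partial>\<mu>s n)) \<le> 1" for n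
    proof (rule AE_I2)
      fix z
      interpret prob_space "\<mu>s n" by (rule \<mu>s)
      have "norm (\<integral>t. iexp ((- ?w z /\<^sub>R h) \<bullet> t) \<partial>\<mu>s n) \<le> (\<integral>t. norm (iexp ((- ?w z /\<^sub>R h) \<bullet> t)) \<partial>\<mu>s n)"
        by (rule integral_norm_bound)
      then show "norm (iexp (?w z \<bullet> x / h) * (\<integral>t. iexp ((- ?w z /\<^sub>R h) \<bullet> t) \<partial>\<mu>s n)) \<le> 1"
        by (simp add: norm_mult prob_space)
    qed
    show "AE z in ?P. (\<lambda>n. iexp (?w z \<bullet> x / h) * (\<integral>t. iexp ((- ?w z /\<^sub>R h) \<bullet> t) \<partial>\<mu>s n))
       \<longlonglongrightarrow> iexp (?w z \<bullet> x / h) * (\<integral>t. iexp ((- ?w z /\<^sub>R h) \<bullet> t) \<partial>\<mu>)"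
      by (intro AE_I2 tendsto_mult tendsto_const conv)
    show "(\<lambda>z. iexp (?w z \<bullet> x / h) * (\<integral>t. iexp ((- ?w z /\<^sub>R h) \<bullet> t) \<partial>\<mu>)) \<in> borel_measurable ?P"
      by (rule integral_gaussian_kernel(2)[OF \<mu>])
    show "(\<lambda>z. iexp (?w z \<bullet> x / h) * (\<integral>t. iexp ((- ?w z /\<^sub>R h) \<bullet> t) \<partial>\<mu>s n)) \<in> borel_measurable ?P" for n
      by (rule integral_gaussian_kernel(2)[OF \<mu>s])
  qed simp
  then have "(\<lambda>n. complex_of_real (\<integral>t. exp (- (norm ((x - t) /\<^sub>R h))\<^sup>2 / 2) \<partial>\<mu>s n))
      \<longlonglongrightarrow> complex_of_real (\<integral>t. exp (- (norm ((x - t) /\<^sub>R h))\<^sup>2 / 2) \<partial>\<mu>)"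
    by (simp only: integral_gaussian_kernel(1)[OF \<mu>s] integral_gaussian_kernel(1)[OF \<mu>])
  then show "(\<lambda>n. \<integral>t. exp (- (norm ((x - t) /\<^sub>R h))\<^sup>2 / 2) \<partial>\<mu>s n)
      \<longlonglongrightarrow> (\<integral>t. exp (- (norm ((x - t) /\<^sub>R h))\<^sup>2 / 2) \<partial>\<mu>)"
    by (simp only: tendsto_of_real_iff)
qed auto

section \<open>Joint distribution functions and weak convergence\<close>

lemma joint_cdf_atMost: "joint_cdf \<mu> u = measure \<mu> {..u}"
  by (simp add: joint_cdf_def less_eq_vec_def atMost_def)

text \<open>
  Each coordinate condition is a difference of indicators of two half-lines; multiplying out gives
  the alternating sum over the corners of the cube. The set \<open>J\<close> collects the coordinates in which the lower corner is
  chosen.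
\<close>

lemma indicator_half_open_cube_as_orthants:
  fixes x t :: "real ^ 'd::finite"
  assumes "h > 0"
  shows "indicator {y. \<forall>i. 0 \<le> y $ i \<and> y $ i < 1} ((x - t) /\<^sub>R h) =
    (\<Sum>J\<in>Pow UNIV. (-1) ^ card J * indicator {..\<chi> i. if i \<in> J then x $ i - h else x $ i} t :: real)"
proof -
  have "indicator {y. \<forall>i. 0 \<le> y $ i \<and> y $ i < 1} ((x - t) /\<^sub>R h)
      = (\<Prod>i\<in>UNIV. indicator {..x $ i} (t $ i) - indicator {..x $ i - h} (t $ i) :: real)"
  proof (cases "\<forall>i. 0 \<le> ((x - t) /\<^sub>R h) $ i \<and> ((x - t) /\<^sub>R h) $ i < 1")
    case True
    then have "t $ i \<le> x $ i \<and> x $ i - h < t $ i" for i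
      using assms by (auto simp: field_simps dest: spec[of _ i])
    then have "indicator {..x $ i} (t $ i) - indicator {..x $ i - h} (t $ i) = (1::real)" for i
      by (simp add: indicator_def not_le)
    then have "(\<Prod>i\<in>UNIV. indicator {..x $ i} (t $ i) - indicator {..x $ i - h} (t $ i) :: real) = 1" by simp
    with True show ?thesis by simp
  next
    case False
    then obtain i where i: "\<not> (0 \<le> ((x - t) /\<^sub>R h) $ i \<and> ((x - t) /\<^sub>R h) $ i < 1)" by blast
    then have "indicator {..x $ i} (t $ i) - indicator {..x $ i - h} (t $ i) = (0::real)"
      using assms by (auto simp: indicator_def field_simps zero_le_mult_iff)
    then have "(\<Prod>i\<in>UNIV. indicator {..x $ i} (t $ i) - indicator {..x $ i - h} (t $ i) :: real) = 0"
      by (intro prod_zero) auto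
    with False show ?thesis by simp
  qed
  also have "\<dots> = (\<Sum>J\<in>Pow UNIV. (-1) ^ card J * (\<Prod>i\<in>J. indicator {..x $ i - h} (t $ i)) *
      (\<Prod>i\<in>UNIV - J. indicator {..x $ i} (t $ i)))"
    by (rule prod_diff_conv_sum) simp
  also have "\<dots> = (\<Sum>J\<in>Pow UNIV. (-1) ^ card J * indicator {..\<chi> i. if i \<in> J then x $ i - h else x $ i} t)"
  proof (rule sum.cong[OF refl])
    fix J :: "'d set"
    have "(\<Prod>i\<in>J. indicator {..x $ i - h} (t $ i)) * (\<Prod>i\<in>UNIV - J. indicator {..x $ i} (t $ i))
        = (\<Prod>i\<in>UNIV. indicator {..if i \<in> J then x $ i - h else x $ i} (t $ i) :: real)"
      by (subst prod.subset_diff[of J UNIV]) (auto simp: mult.commute intro!: arg_cong2[of _ _ _ _ "(*)"] prod.cong)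
    also have "\<dots> = indicator {..\<chi> i. if i \<in> J then x $ i - h else x $ i} t"
    proof (cases "\<forall>i. t $ i \<le> (if i \<in> J then x $ i - h else x $ i)")
      case True then show ?thesis by (simp add: less_eq_vec_def)
    next
      case False
      then obtain i where "\<not> t $ i \<le> (if i \<in> J then x $ i - h else x $ i)" by blast
      then have "(\<Prod>i\<in>UNIV. indicator {..if i \<in> J then x $ i - h else x $ i} (t $ i) :: real) = 0"
        by (intro prod_zero bexI[of _ i]) (auto simp: indicator_def)
      moreover have "indicator {..\<chi> i. if i \<in> J then x $ i - h else x $ i} t = (0 :: real)"
        using False by (subst indicator_simps(2)) (simp_all only: atMost_iff less_eq_vec_def vec_lambda_beta not_False_eq_True)
      ultimately show ?thesis by simp
    qed
    finally show "(-1) ^ card J * (\<Prod>i\<in>J. indicator {..x $ i - h} (t $ i)) * (\<Prod>i\<in>UNIV - J. indicator {..x $ i} (t $ i))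
       = (-1) ^ card J * (indicator {..\<chi> i. if i \<in> J then x $ i - h else x $ i} t :: real)"
      by (simp only: mult.assoc)
  qed
  finally show ?thesis .
qed

text \<open>
  Smoothing with the indicator of the unit cube expresses the smoothed laws as
  finite linear combinations of values of the distribution function.
\<close>

lemma weak_conv_borel_if_joint_cdf:
  fixes \<mu>s :: "nat \<Rightarrow> (real ^ 'd::finite) measure"
  assumes \<mu>s: "\<And>n. prob_space (\<mu>s n)" "\<And>n. sets (\<mu>s n) = sets borel"
    and \<mu>: "prob_space \<mu>" "sets \<mu> = sets borel"
    and conv: "\<And>u. (\<lambda>n. joint_cdf (\<mu>s n) u) \<longlonglongrightarrow> joint_cdf \<mu> u"
  shows "weak_conv_borel \<mu>s \<mu>"
proof -
  let ?Q = "{y :: real ^ 'd. \<forall>i. 0 \<le> y $ i \<and> y $ i < 1}"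
  have meas: "?Q \<in> sets borel" by measurable
  have sub: "box 0 1 \<subseteq> ?Q" "?Q \<subseteq> cbox 0 1"
    by (auto simp: mem_box_cart less_imp_le)
  have fin: "emeasure lborel ?Q < \<infinity>"
    using emeasure_mono[OF sub(2), of lborel] emeasure_lborel_cbox_finite[of "0 :: real ^ 'd" 1]
    by (auto intro: le_less_trans)
  have "emeasure lborel (box 0 (1 :: real ^ 'd)) = 1"
    by (subst emeasure_lborel_box) (auto simp: Basis_vec_def inner_axis inner_axis' intro!: prod.neutral)
  then have "emeasure lborel ?Q \<ge> 1"
    using emeasure_mono[OF sub(1), of lborel] meas by auto
  then have "emeasure lborel ?Q > 0" by (rule less_le_trans[OF zero_less_one])
  then have pos: "measure lborel ?Q > 0"
    using fin by (simp add: measure_def enn2real_positive_iff)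
  have eq: "(\<integral>t. indicator ?Q ((x - t) /\<^sub>R h) \<partial>\<rho>)
      = (\<Sum>J\<in>Pow UNIV. (-1) ^ card J * joint_cdf \<rho> (\<chi> i. if i \<in> J then x $ i - h else x $ i))"
    if "prob_space \<rho>" "sets \<rho> = sets borel" "h > 0" for \<rho> :: "(real ^ 'd) measure" and h x
  proof -
    interpret prob_space \<rho> by fact
    have int: "integrable \<rho> (indicator {..u} :: _ \<Rightarrow> real)" for u
      using that(2) by (intro integrable_real_indicator) (auto simp: less_top[symmetric])
    show ?thesis
      unfolding indicator_half_open_cube_as_orthants[OF \<open>h > 0\<close>]
      using int that(2) by (subst Bochner_Integration.integral_sum) (auto simp: joint_cdf_atMost)
  qed
  show ?thesis
  proof (rule weak_conv_borel_if_smoothed[OF \<mu>s \<mu>, where K="indicator ?Q" and B=1])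
    show "integrable lborel (indicator ?Q :: _ \<Rightarrow> real)"
      using fin meas by (intro integrable_real_indicator) auto
    show "0 < (\<integral>x. indicator ?Q x \<partial>lborel :: real)" using pos meas by simp
    show "(\<lambda>n. \<integral>t. indicator ?Q ((x - t) /\<^sub>R h) \<partial>\<mu>s n) \<longlonglongrightarrow> (\<integral>t. indicator ?Q ((x - t) /\<^sub>R h) \<partial>\<mu> :: real)"
      if "h > 0" for h x
      unfolding eq[OF \<mu>s that] eq[OF \<mu> that] by (intro tendsto_sum tendsto_mult tendsto_const conv)
  qed (auto simp: indicator_def)
qed

text \<open>
  The indicator of the orthant below \<open>u\<close> is squeezed between continuous functions, products
  of steep ramps that descend from 1 to 0 just before, respectively just after, the coordinates of \<open>u\<close>. As the
  ramps get steeper, both integrals under the limit law tend to its distribution function, because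
  it does not charge the boundary of the orthant.
\<close>

lemma tendsto_joint_cdf_if_weak_conv:
  fixes \<mu>s :: "nat \<Rightarrow> (real ^ 'd::finite) measure"
  assumes \<mu>s: "\<And>n. prob_space (\<mu>s n)" "\<And>n. sets (\<mu>s n) = sets borel"
    and \<mu>: "prob_space \<mu>" "sets \<mu> = sets borel"
    and conv: "weak_conv_borel \<mu>s \<mu>"
    and null: "\<And>i. measure \<mu> {x. x $ i = u $ i} = 0"
  shows "(\<lambda>n. joint_cdf (\<mu>s n) u) \<longlonglongrightarrow> joint_cdf \<mu> u"
proof -
  interpret \<mu>: prob_space \<mu> by fact
  note [measurable_cong] = \<mu>(2)
  define g where "g m s x = (\<Prod>i\<in>UNIV. max 0 (min 1 (s + real m * (u $ i - x $ i))))" for m :: nat and s :: real and x :: "real ^ 'd"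
  have gc: "continuous_on UNIV (g m s)" for m s unfolding g_def by (intro continuous_intros)
  then have [measurable]: "g m s \<in> borel_measurable borel" for m s by (rule borel_measurable_continuous_onI)
  have g01: "0 \<le> g m s x" "g m s x \<le> 1" for m s x
    unfolding g_def by (auto intro!: prod_nonneg prod_le_1)
  have conv_g: "(\<lambda>n. \<integral>x. g m s x \<partial>\<mu>s n) \<longlonglongrightarrow> (\<integral>x. g m s x \<partial>\<mu>)" for m s
  proof -
    have "bounded (range (g m s))" using g01 by (auto simp: bounded_iff intro!: exI[of _ 1])
    then show ?thesis using conv gc unfolding weak_conv_borel_def by blast
  qed
  have lower: "g m 0 x \<le> indicator {..u} x" for m x
  proof (cases "x \<le> u")
    case False
    then obtain i where "u $ i < x $ i" by (auto simp: less_eq_vec_def not_le)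
    then have "real m * (u $ i - x $ i) \<le> 0" by (simp add: mult_nonneg_nonpos)
    then have "g m 0 x = 0" unfolding g_def by (intro prod_zero bexI[of _ i]) auto
    then show ?thesis by simp
  qed (use g01 in auto)
  have upper: "indicator {..u} x \<le> g m 1 x" for m x
  proof (cases "x \<le> u")
    case True
    then have "g m 1 x = 1" unfolding g_def by (auto simp: less_eq_vec_def intro!: prod.neutral)
    then show ?thesis by (simp add: indicator_def)
  qed (use g01 in auto)
  have AE: "AE x in \<mu>. \<forall>i. x $ i \<noteq> u $ i"
  proof -
    have "AE x in \<mu>. x $ i \<noteq> u $ i" for i
    proof (rule AE_I')
      show "{x. x $ i = u $ i} \<in> null_sets \<mu>"
        using null[of i] by (auto simp: null_sets_def \<mu>.emeasure_eq_measure)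
    qed auto
    then show ?thesis by (simp add: AE_all_countable)
  qed
  have lim: "(\<lambda>m. \<integral>x. g m s x \<partial>\<mu>) \<longlonglongrightarrow> (\<integral>x. indicator {..u} x \<partial>\<mu>)" for s
  proof (rule integral_dominated_convergence[where w="\<lambda>_. 1"])
    show "AE x in \<mu>. (\<lambda>m. g m s x) \<longlonglongrightarrow> indicator {..u} x"
      using AE
    proof eventually_elim
      case (elim x)
      have 1: "(\<lambda>m. max 0 (min 1 (s + real m * (u $ i - x $ i)))) \<longlonglongrightarrow> (if x $ i \<le> u $ i then 1 else 0)" for i
      proof (cases "x $ i < u $ i")
        case True
        then have "filterlim (\<lambda>m. s + real m * (u $ i - x $ i)) at_top sequentially"
          by (intro filterlim_tendsto_add_at_top[OF tendsto_const] filterlim_at_top_mult_tendsto_pos[OF tendsto_const] filterlim_real_sequentially) auto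
        then have "\<forall>\<^sub>F m in sequentially. s + real m * (u $ i - x $ i) \<ge> 1"
          unfolding filterlim_at_top by (rule spec)
        then have "\<forall>\<^sub>F m in sequentially. max 0 (min 1 (s + real m * (u $ i - x $ i))) = 1"
          by eventually_elim auto
        then show ?thesis using True by (simp add: tendsto_eventually)
      next
        case False
        with elim have *: "u $ i < x $ i" by (metis linorder_neqE)
        then have "filterlim (\<lambda>m. - s + real m * (x $ i - u $ i)) at_top sequentially"
          by (intro filterlim_tendsto_add_at_top[OF tendsto_const] filterlim_at_top_mult_tendsto_pos[OF tendsto_const] filterlim_real_sequentially) auto
        then have "\<forall>\<^sub>F m in sequentially. - s + real m * (x $ i - u $ i) \<ge> 0"
          unfolding filterlim_at_top by (rule spec)
        then have "\<forall>\<^sub>F m in sequentially. max 0 (min 1 (s + real m * (u $ i - x $ i))) = 0"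
          by eventually_elim (auto simp: algebra_simps)
        then show ?thesis using * by (simp add: tendsto_eventually)
      qed
      have "(\<lambda>m. g m s x) \<longlonglongrightarrow> (\<Prod>i\<in>UNIV. if x $ i \<le> u $ i then 1 else 0)"
        unfolding g_def by (intro tendsto_prod 1)
      also have "(\<Prod>i\<in>UNIV. if x $ i \<le> u $ i then 1 else 0) = (indicator {..u} x :: real)"
        by (auto simp: less_eq_vec_def indicator_def intro!: prod.neutral prod_zero)
      finally show ?case .
    qed
  qed (use g01 in auto)
  have eq: "joint_cdf \<rho> u = (\<integral>x. indicator {..u} x \<partial>\<rho>)" if "sets \<rho> = sets borel" for \<rho>
    using that sets_eq_imp_space_eq[OF that] by (simp add: joint_cdf_atMost)
  have bounds: "(\<integral>x. g m 0 x \<partial>\<rho>) \<le> joint_cdf \<rho> u" "joint_cdf \<rho> u \<le> (\<integral>x. g m 1 x \<partial>\<rho>)"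
    if \<rho>: "prob_space \<rho>" "sets \<rho> = sets borel" for \<rho> m
  proof -
    interpret prob_space \<rho> by fact
    note [measurable_cong] = \<rho>(2)
    have i: "integrable \<rho> (g m s)" for s using g01 by (intro integrable_const_bound[where B=1]) auto
    have i2: "integrable \<rho> (indicator {..u} :: _ \<Rightarrow> real)" by (intro integrable_const_bound[where B=1]) auto
    show "(\<integral>x. g m 0 x \<partial>\<rho>) \<le> joint_cdf \<rho> u" "joint_cdf \<rho> u \<le> (\<integral>x. g m 1 x \<partial>\<rho>)"
      unfolding eq[OF \<rho>(2)] by (intro integral_mono i i2 lower upper)+
  qed
  show ?thesis
  proof (rule tendstoI)
    fix e :: real assume "e > 0"
    have "\<forall>\<^sub>F m in sequentially. dist (\<integral>x. g m s x \<partial>\<mu>) (joint_cdf \<mu> u) < e / 2" for s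
      using lim[of s] \<open>e > 0\<close> unfolding eq[OF \<mu>(2)] by (intro tendstoD) auto
    from eventually_happens'[OF sequentially_bot eventually_conj[OF this[of 0] this[of 1]]]
    obtain m where m: "dist (\<integral>x. g m 0 x \<partial>\<mu>) (joint_cdf \<mu> u) < e / 2" "dist (\<integral>x. g m 1 x \<partial>\<mu>) (joint_cdf \<mu> u) < e / 2"
      by blast
    have "\<forall>\<^sub>F n in sequentially. dist (\<integral>x. g m s x \<partial>\<mu>s n) (\<integral>x. g m s x \<partial>\<mu>) < e / 2" for s
      using conv_g[of m s] \<open>e > 0\<close> by (intro tendstoD) auto
    from eventually_conj[OF this[of 0] this[of 1]]
    show "\<forall>\<^sub>F n in sequentially. dist (joint_cdf (\<mu>s n) u) (joint_cdf \<mu> u) < e"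
    proof eventually_elim
      case (elim n)
      show ?case
        using elim m bounds[OF \<mu>s(1)[of n] \<mu>s(2)[of n], of m] unfolding dist_real_def by linarith
    qed
  qed
qed

section \<open>Multivariate normal laws\<close>

text \<open>
  Cholesky elimination. Subtracting from \<open>S\<close> the rank-one matrix \<open>v v\<^sup>T\<close>, where \<open>v\<close> is the
  \<open>i\<close>-th column divided by the root of the diagonal entry, leaves a positive semidefinite matrix with one more vanishing
  diagonal entry. The second conjunct keeps the \<open>i\<close>-th column of the factor of the
  remainder free, so that \<open>v\<close> can be stored there without creating cross terms.
\<close>

lemma psd_factorization:
  fixes S :: "real ^ 'd::finite ^ 'd"
  assumes sym: "\<And>i j. S $ i $ j = S $ j $ i" and psd: "\<And>x. 0 \<le> x \<bullet> (S *v x)"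
  shows "\<exists>A :: real ^ 'd ^ 'd. A ** transpose A = S \<and> (\<forall>j. S $ j $ j = 0 \<longrightarrow> (\<forall>r. A $ r $ j = 0))"
  using assms
proof (induction "card {i. S $ i $ i \<noteq> 0}" arbitrary: S rule: less_induct)
  case (less S)
  have form: "x \<bullet> (T *v y) = (\<Sum>i\<in>UNIV. \<Sum>j\<in>UNIV. x $ i * T $ i $ j * y $ j)" for T :: "real ^ 'd ^ 'd" and x y
    by (simp add: inner_vec_def matrix_vector_mult_def sum_distrib_left mult.assoc)
  have axis: "axis i 1 \<bullet> (T *v axis j 1) = T $ i $ j" for T :: "real ^ 'd ^ 'd" and i j
    by (simp add: inner_axis' matrix_vector_mul_component inner_axis)
  have diag: "0 \<le> S $ i $ i" for i using less.prems(2)[of "axis i 1"] by (simp add: axis)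
  have adj: "x \<bullet> (S *v y) = y \<bullet> (S *v x)" for x y
    unfolding form by (subst sum.swap) (simp add: less.prems(1) mult_ac)
  show ?case
  proof (cases "\<exists>i. S $ i $ i \<noteq> 0")
    case False
    have "S $ i $ j = 0" for i j
    proof -
      \<comment> \<open>With a vanishing diagonal the quadratic form at \<open>e\<^sub>i + c e\<^sub>j\<close> is linear in \<open>c\<close>.\<close>
      have q: "0 \<le> 2 * c * S $ i $ j" for c
        using less.prems(2)[of "axis i 1 + c *\<^sub>R axis j 1"] False adj[of "axis j 1" "axis i 1"]
        by (simp add: matrix_vector_right_distrib matrix_vector_mult_scaleR inner_add_left inner_add_right axis algebra_simps)
      show ?thesis using q[of 1] q[of "-1"] by simp
    qed
    then have "S = 0" by (simp add: vec_eq_iff)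
    then show ?thesis by (intro exI[of _ 0]) (simp add: matrix_matrix_mult_def vec_eq_iff)
  next
    case True
    then obtain i where "S $ i $ i \<noteq> 0" by blast
    with diag[of i] have i: "S $ i $ i > 0" by simp
    define v where "v r = S $ r $ i / sqrt (S $ i $ i)" for r
    define S' :: "real ^ 'd ^ 'd" where "S' = (\<chi> r c. S $ r $ c - v r * v c)"
    have sym': "S' $ r $ c = S' $ c $ r" for r c
      using less.prems(1)[of r c] by (simp add: S'_def)
    have psd': "0 \<le> x \<bullet> (S' *v x)" for x
    proof -
      define l where "l = axis i 1 \<bullet> (S *v x)"
      \<comment> \<open>The multiple of \<open>e\<^sub>i\<close> that minimizes the quadratic form at \<open>x - c e\<^sub>i\<close>; the minimum is the form of \<open>S'\<close> at \<open>x\<close>.\<close>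
      define c where "c = l / S $ i $ i"
      have "0 \<le> (x - c *\<^sub>R axis i 1) \<bullet> (S *v (x - c *\<^sub>R axis i 1))" by (rule less.prems)
      also have "\<dots> = x \<bullet> (S *v x) - 2 * c * l + c\<^sup>2 * S $ i $ i"
        using adj[of x "axis i 1"]
        by (simp add: matrix_vector_mult_diff_distrib matrix_vector_mult_scaleR inner_diff_left inner_diff_right
            axis l_def power2_eq_square algebra_simps)
      also have "\<dots> = x \<bullet> (S *v x) - l\<^sup>2 / S $ i $ i"
        using i by (simp add: c_def power2_eq_square)
      also have "l = (\<Sum>r\<in>UNIV. S $ r $ i * x $ r)"
        unfolding l_def by (simp add: inner_axis' matrix_vector_mult_def less.prems(1)[of i])
      also have "(\<dots>)\<^sup>2 / S $ i $ i = (\<Sum>r\<in>UNIV. v r * x $ r)\<^sup>2"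
        using i by (simp add: v_def sum_divide_distrib[symmetric] power_divide)
      also have "x \<bullet> (S *v x) - (\<Sum>r\<in>UNIV. v r * x $ r)\<^sup>2 = x \<bullet> (S' *v x)"
        unfolding form power2_eq_square sum_product
        by (simp add: S'_def sum_subtractf algebra_simps)
      finally show ?thesis .
    qed
    have axis': "S' $ j $ j \<ge> 0" for j using psd'[of "axis j 1"] by (simp add: axis)
    have S'i: "S' $ i $ i = 0" using i by (simp add: S'_def v_def)
    have mono: "S' $ j $ j = 0" if "S $ j $ j = 0" for j
    proof -
      have "S' $ j $ j = S $ j $ j - v j * v j" by (simp add: S'_def)
      then show ?thesis using axis'[of j] that zero_le_square[of "v j"] by linarith
    qed
    have "card {i. S' $ i $ i \<noteq> 0} < card {i. S $ i $ i \<noteq> 0}"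
    proof (rule psubset_card_mono)
      show "{i. S' $ i $ i \<noteq> 0} \<subset> {i. S $ i $ i \<noteq> 0}"
      proof
        show "{i. S' $ i $ i \<noteq> 0} \<subseteq> {i. S $ i $ i \<noteq> 0}"
          by (intro Collect_mono impI notI) (erule notE, rule mono)
        have "i \<in> {i. S $ i $ i \<noteq> 0}" "i \<notin> {i. S' $ i $ i \<noteq> 0}" using S'i i by simp_all
        then show "{i. S' $ i $ i \<noteq> 0} \<noteq> {i. S $ i $ i \<noteq> 0}" by metis
      qed
    qed simp
    from less.hyps[OF this sym' psd'] obtain A' :: "real ^ 'd ^ 'd"
      where A': "A' ** transpose A' = S'" "\<And>j r. S' $ j $ j = 0 \<Longrightarrow> A' $ r $ j = 0" by blast
    define A :: "real ^ 'd ^ 'd" where "A = (\<chi> r c. A' $ r $ c + (if c = i then v r else 0))"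
    have "(A ** transpose A) $ r $ c = S $ r $ c" for r c
    proof -
      have "(A ** transpose A) $ r $ c = (\<Sum>k\<in>UNIV. A $ r $ k * A $ c $ k)"
        by (simp add: matrix_matrix_mult_def transpose_def)
      also have "\<dots> = (\<Sum>k\<in>UNIV. A' $ r $ k * A' $ c $ k + (if k = i then v r * v c else 0))"
        using A'(2)[OF S'i] by (intro sum.cong) (auto simp: A_def)
      also have "\<dots> = (A' ** transpose A') $ r $ c + v r * v c"
        by (simp add: sum.distrib matrix_matrix_mult_def transpose_def)
      also have "\<dots> = S $ r $ c" unfolding A' by (simp add: S'_def)
      finally show ?thesis .
    qed
    moreover have "A $ r $ j = 0" if "S $ j $ j = 0" for j r
      using A'(2)[OF mono[OF that]] that i by (auto simp: A_def)
    ultimately show ?thesis by (intro exI[of _ A]) (auto simp: vec_eq_iff)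
  qed
qed

text \<open>
  The characteristic function depends on the factor \<open>A\<close> only through \<open>A A\<^sup>T = S\<close>, since
  \<open>s \<bullet> A z\<close> is a linear combination of the normal coordinates with squared length \<open>s \<bullet> S s\<close>.
\<close>

lemma mv_normal_law:
  fixes \<nu> :: "(real ^ 'd::finite) measure"
  assumes "is_mv_normal \<nu> 0 S"
  shows "prob_space \<nu>" "sets \<nu> = sets borel"
    and "(\<integral>x. iexp (s \<bullet> x) \<partial>\<nu>) = complex_of_real (exp (- (s \<bullet> (S *v s)) / 2))"
proof -
  obtain A where A: "A ** transpose A = S"
    and \<nu>0: "\<nu> = distr (\<Pi>\<^sub>M i\<in>(UNIV :: 'd set). std_normal_distribution) borel (\<lambda>z. 0 + A *v (\<chi> i. z i))"
    using assms unfolding is_mv_normal_def by blast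
  have \<nu>: "\<nu> = distr (\<Pi>\<^sub>M i\<in>(UNIV :: 'd set). std_normal_distribution) borel (\<lambda>z. A *v (\<chi> i. z i))"
    unfolding \<nu>0 by simp
  let ?P = "\<Pi>\<^sub>M i\<in>(UNIV :: 'd set). std_normal_distribution"
  interpret N: real_distribution std_normal_distribution by (rule real_dist_normal_dist)
  interpret P: prob_space ?P by (rule prob_space_PiM) (rule N.prob_space_axioms)
  have [measurable]: "(\<lambda>z. A *v (\<chi> i. z i)) \<in> borel_measurable ?P"
    unfolding borel_measurable_euclidean_space[of "\<lambda>z. A *v (\<chi> i. z i)"]
    by (auto simp: Basis_vec_def inner_axis matrix_vector_mult_def)
  show "prob_space \<nu>" unfolding \<nu> by (rule P.prob_space_distr) measurable
  show "sets \<nu> = sets borel" unfolding \<nu> by simp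
  have eq: "s \<bullet> (A *v (\<chi> i. z i)) = (\<Sum>i\<in>UNIV. (s v* A) $ i * z i)" for z
    unfolding dot_lmul_matrix[symmetric] by (simp add: inner_vec_def)
  have "(\<integral>x. iexp (s \<bullet> x) \<partial>\<nu>) = (\<integral>z. iexp (\<Sum>i\<in>UNIV. (s v* A) $ i * z i) \<partial>?P)"
    unfolding \<nu> by (subst integral_distr) (auto simp: eq)
  also have "\<dots> = complex_of_real (exp (- (\<Sum>i\<in>UNIV. ((s v* A) $ i)\<^sup>2) / 2))"
    by (rule integral_iexp_PiM_std_normal) simp
  also have "(\<Sum>i\<in>UNIV. ((s v* A) $ i)\<^sup>2) = (s v* A) \<bullet> (s v* A)"
    by (simp add: inner_vec_def power2_eq_square)
  also have "\<dots> = s \<bullet> (S *v s)"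
    unfolding dot_lmul_matrix A[symmetric] by (simp add: matrix_vector_mul_assoc[symmetric])
  finally show "(\<integral>x. iexp (s \<bullet> x) \<partial>\<nu>) = complex_of_real (exp (- (s \<bullet> (S *v s)) / 2))" .
qed

text \<open>
  The \<open>i\<close>-th marginal has the characteristic function of the standard normal law, hence is that law
  and has no atoms, even if \<open>S\<close> is singular.
\<close>

lemma mv_normal_hyperplane_null:
  fixes \<nu> :: "(real ^ 'd::finite) measure"
  assumes \<nu>: "is_mv_normal \<nu> 0 S" and S: "S $ i $ i = 1"
  shows "measure \<nu> {x. x $ i = c} = 0"
proof -
  interpret prob_space \<nu> using \<nu> by (rule mv_normal_law)
  note [measurable_cong] = mv_normal_law(2)[OF \<nu>]
  interpret d: real_distribution "distr \<nu> borel (\<lambda>x. x $ i)"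
    by (intro real_distribution_distr) measurable
  have "char (distr \<nu> borel (\<lambda>x. x $ i)) t = char std_normal_distribution t" for t
  proof -
    have "char (distr \<nu> borel (\<lambda>x. x $ i)) t = (\<integral>x. iexp ((t *\<^sub>R axis i 1) \<bullet> x) \<partial>\<nu>)"
      unfolding char_def by (subst integral_distr) (auto simp: inner_axis')
    also have "\<dots> = char std_normal_distribution t"
      unfolding mv_normal_law(3)[OF \<nu>] char_std_normal_distribution
      using S by (simp add: matrix_vector_mult_scaleR inner_axis' matrix_vector_mul_component inner_axis power2_eq_square)
    finally show ?thesis .
  qed
  then have eq: "distr \<nu> borel (\<lambda>x. x $ i) = std_normal_distribution"
    by (intro Levy_uniqueness d.real_distribution_axioms real_dist_normal_dist) auto
  have "measure \<nu> {x. x $ i = c} = measure (distr \<nu> borel (\<lambda>x. x $ i)) {c}"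
    using sets_eq_imp_space_eq[OF mv_normal_law(2)[OF \<nu>]]
    by (subst measure_distr) (auto intro!: arg_cong[where f="measure \<nu>"])
  also have "\<dots> = 0"
    unfolding eq by (simp add: measure_def emeasure_density nn_integral_null_delta)
  finally show ?thesis .
qed

lemma exists_mv_normal:
  fixes S :: "real ^ 'd::finite ^ 'd"
  assumes "\<And>i j. S $ i $ j = S $ j $ i" "\<And>x. 0 \<le> x \<bullet> (S *v x)"
  shows "\<exists>\<nu>. is_mv_normal \<nu> 0 S"
  using psd_factorization[OF assms] unfolding is_mv_normal_def by metis

section \<open>A central limit theorem for triangular arrays of random vectors\<close>

lemma abs_exp_minus_linear_le:
  assumes "0 \<le> (y::real)"
  shows "\<bar>exp (- y) - (1 - y)\<bar> \<le> y\<^sup>2"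
proof -
  have "1 + y \<le> exp y" by (rule exp_ge_add_one_self)
  then have "exp (- y) \<le> 1 / (1 + y)"
    using assms by (simp add: exp_minus field_simps)
  also have "\<dots> \<le> 1 - y + y\<^sup>2"
    using assms by (simp add: field_simps power2_eq_square)
  finally show ?thesis using exp_ge_add_one_self[of "- y"] by (simp add: abs_le_iff)
qed

text \<open>
  With variance \<open>s\<close>, both the characteristic function at 1 and \<open>exp (- s / 2)\<close> agree
  with \<open>1 - s / 2\<close> up to an error of order \<open>s b\<close>. Taking \<open>n\<close>-th powers multiplies the
  error by at most \<open>n\<close>, and \<open>n s b\<close> tends to 0 since \<open>n s\<close> converges. Comparing with \<open>exp (- s / 2)\<close>
  rather than \<open>1 - s / 2\<close> makes the \<open>n\<close>-th power explicit. The mean is required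
  to vanish only eventually because thresholds may leave the unit interval for small \<open>n\<close>.
\<close>

lemma tendsto_char_power_triangular:
  fixes L :: "nat \<Rightarrow> real measure"
  assumes L: "\<And>n. real_distribution (L n)"
    and bound: "\<And>n. AE x in L n. \<bar>x\<bar> \<le> b n" and b: "b \<longlonglongrightarrow> 0"
    and mean: "\<forall>\<^sub>F n in sequentially. (\<integral>x. x \<partial>L n) = 0"
    and var: "(\<lambda>n. real n * (\<integral>x. x\<^sup>2 \<partial>L n)) \<longlonglongrightarrow> v"
  shows "(\<lambda>n. char (L n) 1 ^ n) \<longlonglongrightarrow> complex_of_real (exp (- v / 2))"
proof -
  define s where "s n = (\<integral>x. x\<^sup>2 \<partial>L n)" for n
  have s0: "0 \<le> s n" for n by (simp add: s_def)
  have b0: "0 \<le> b n" for n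
  proof -
    interpret real_distribution "L n" by (rule L)
    have "AE x in L n. 0 \<le> b n" using bound[of n] by eventually_elim auto
    then show ?thesis by simp
  qed
  have int: "integrable (L n) (\<lambda>x. x ^ m)" for m n
  proof -
    interpret real_distribution "L n" by (rule L)
    show ?thesis
    proof (rule integrable_const_bound[where B="b n ^ m"])
      show "AE x in L n. norm (x ^ m) \<le> b n ^ m"
        using bound[of n] by eventually_elim (auto simp: power_abs intro: power_mono)
    qed simp
  qed
  have sb: "s n \<le> (b n)\<^sup>2" for n
  proof -
    interpret real_distribution "L n" by (rule L)
    have "AE x in L n. x\<^sup>2 \<le> (b n)\<^sup>2"
      using bound[of n] by eventually_elim (use b0 in \<open>auto simp: abs_le_square_iff[symmetric]\<close>)
    then show ?thesis unfolding s_def by (intro integral_le_const int)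
  qed
  have step: "norm (char (L n) 1 ^ n - complex_of_real (exp (- (real n * s n) / 2)))
      \<le> real n * s n * b n + real n * s n * (b n)\<^sup>2" if m: "(\<integral>x. x \<partial>L n) = 0" for n
  proof -
    interpret real_distribution "L n" by (rule L)
    have "variance (\<lambda>x. x) = s n" using m by (simp add: s_def)
    then have "norm (char (L n) 1 - (1 - 1\<^sup>2 * s n / 2)) \<le> 1\<^sup>2 / 6 * (\<integral>x. min (6 * x\<^sup>2) (\<bar>1\<bar> * \<bar>x\<bar> ^ 3) \<partial>L n)"
      using int[of n 1] int[of n 2] m by (intro char_approx3) auto
    also have "(\<integral>x. min (6 * x\<^sup>2) (\<bar>1\<bar> * \<bar>x\<bar> ^ 3) \<partial>L n) \<le> (\<integral>x. b n * x\<^sup>2 \<partial>L n)"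
    proof (rule integral_mono_AE)
      show i2: "integrable (L n) (\<lambda>x. b n * x\<^sup>2)" using int[of n 2] by simp
      show le: "AE x in L n. min (6 * x\<^sup>2) (\<bar>1\<bar> * \<bar>x\<bar> ^ 3) \<le> b n * x\<^sup>2"
        using bound[of n]
      proof eventually_elim
        case (elim x)
        have "\<bar>x\<bar> ^ 3 = \<bar>x\<bar> * x\<^sup>2" by (simp add: power3_eq_cube power2_eq_square)
        also have "\<dots> \<le> b n * x\<^sup>2" using elim by (intro mult_right_mono) auto
        finally show ?case by (simp add: min_le_iff_disj)
      qed
      show "integrable (L n) (\<lambda>x. min (6 * x\<^sup>2) (\<bar>1\<bar> * \<bar>x\<bar> ^ 3))"
        by (rule Bochner_Integration.integrable_bound[OF i2]) (use le in \<open>auto elim!: eventually_mono\<close>)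
    qed
    also have "(\<integral>x. b n * x\<^sup>2 \<partial>L n) = b n * s n" by (simp add: s_def)
    finally have 1: "norm (char (L n) 1 - complex_of_real (1 - s n / 2)) \<le> b n * s n / 6" by simp
    have "\<bar>exp (- (s n / 2)) - (1 - s n / 2)\<bar> \<le> (s n / 2)\<^sup>2"
      using s0 by (intro abs_exp_minus_linear_le) simp
    also have "\<dots> = s n * s n / 4" by (simp add: power2_eq_square)
    also have "\<dots> \<le> s n * (b n)\<^sup>2 / 4" using sb[of n] s0[of n] by (simp add: mult_left_mono)
    finally have "norm (complex_of_real (1 - s n / 2) - complex_of_real (exp (- (s n / 2)))) \<le> s n * (b n)\<^sup>2 / 4"
      unfolding of_real_diff[symmetric] norm_of_real by linarith
    with 1 have 2: "norm (char (L n) 1 - complex_of_real (exp (- (s n / 2)))) \<le> b n * s n / 6 + s n * (b n)\<^sup>2 / 4"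
      by (rule norm_diff_triangle_le)
    also have "\<dots> \<le> s n * b n + s n * (b n)\<^sup>2"
      using mult_nonneg_nonneg[OF s0[of n] b0[of n]] mult_nonneg_nonneg[OF s0[of n] zero_le_power2[of "b n"]]
      unfolding mult.commute[of "b n" "s n"] by linarith
    finally have 3: "norm (char (L n) 1 - complex_of_real (exp (- (s n / 2)))) \<le> s n * b n + s n * (b n)\<^sup>2" .
    have "complex_of_real (exp (- (real n * s n) / 2)) = complex_of_real (exp (- (s n / 2))) ^ n"
      by (simp add: exp_of_nat_mult[symmetric] flip: of_real_power)
    then have "norm (char (L n) 1 ^ n - complex_of_real (exp (- (real n * s n) / 2)))
        = norm (char (L n) 1 ^ n - complex_of_real (exp (- (s n / 2))) ^ n)" by simp
    also have "\<dots> \<le> real n * norm (char (L n) 1 - complex_of_real (exp (- (s n / 2))))"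
      using cmod_char_le_1 s0[of n] by (intro norm_power_diff) auto
    also have "\<dots> \<le> real n * (s n * b n + s n * (b n)\<^sup>2)" by (intro mult_left_mono 3) simp
    finally show ?thesis by (simp add: algebra_simps)
  qed
  have "(\<lambda>n. real n * s n * b n + real n * s n * (b n)\<^sup>2) \<longlonglongrightarrow> v * 0 + v * 0\<^sup>2"
    using var b unfolding s_def by (intro tendsto_intros)
  then have "(\<lambda>n. real n * s n * b n + real n * s n * (b n)\<^sup>2) \<longlonglongrightarrow> 0" by simp
  moreover have "\<forall>\<^sub>F n in sequentially. norm (char (L n) 1 ^ n - complex_of_real (exp (- (real n * s n) / 2)))
      \<le> real n * s n * b n + real n * s n * (b n)\<^sup>2"
    using mean by eventually_elim (rule step)
  ultimately have "(\<lambda>n. char (L n) 1 ^ n - complex_of_real (exp (- (real n * s n) / 2))) \<longlonglongrightarrow> 0"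
    by (rule Lim_null_comparison[rotated])
  moreover have "(\<lambda>n. complex_of_real (exp (- (real n * s n) / 2))) \<longlonglongrightarrow> complex_of_real (exp (- v / 2))"
    using var unfolding s_def by (intro tendsto_intros) auto
  ultimately show ?thesis using tendsto_add by force
qed

lemma borel_measurable_vec_nth_comp [measurable (raw)]:
  fixes f :: "'a \<Rightarrow> real ^ 'd::finite"
  assumes "f \<in> borel_measurable M"
  shows "(\<lambda>x. f x $ i) \<in> borel_measurable M"
  by (rule measurable_compose[OF assms borel_measurable_nth])

text \<open>
  Every linear functional of the array has the quadratic form of \<open>S\<close> as its limiting variance. This serves
  the central limit theorem and also shows that \<open>S\<close> is positive semidefinite.
\<close>

lemma tendsto_second_moment:
  fixes \<mu> :: "'b measure" and Y :: "nat \<Rightarrow> 'b \<Rightarrow> real ^ 'd::finite"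
  assumes \<mu>: "prob_space \<mu>" and Y [measurable]: "\<And>n. Y n \<in> borel_measurable \<mu>"
    and bound: "\<And>n x. norm (Y n x) \<le> b n"
    and cov: "\<And>i j. (\<lambda>n. real n * (\<integral>x. Y n x $ i * Y n x $ j \<partial>\<mu>)) \<longlonglongrightarrow> S $ i $ j"
  shows "(\<lambda>n. real n * (\<integral>x. (s \<bullet> Y n x)\<^sup>2 \<partial>\<mu>)) \<longlonglongrightarrow> s \<bullet> (S *v s)"
proof -
  interpret prob_space \<mu> by fact
  have comp: "\<bar>Y n x $ i\<bar> \<le> b n" for n x i
    using component_le_norm_cart[of "Y n x" i] bound[of n x] by linarith
  have "\<bar>Y n x $ i * Y n x $ j\<bar> \<le> b n * b n" for n x i j
    unfolding abs_mult using comp[of n x] by (intro mult_mono) (auto intro: order_trans[OF abs_ge_zero])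
  then have int: "integrable \<mu> (\<lambda>x. Y n x $ i * Y n x $ j)" for n i j
    by (intro integrable_const_bound[where B="b n * b n"]) auto
  have sq: "(s \<bullet> Y n x)\<^sup>2 = (\<Sum>i\<in>UNIV. \<Sum>j\<in>UNIV. s $ i * s $ j * (Y n x $ i * Y n x $ j))" for n x
    by (simp add: inner_vec_def power2_eq_square sum_product mult_ac)
  have "real n * (\<integral>x. (s \<bullet> Y n x)\<^sup>2 \<partial>\<mu>)
      = (\<Sum>i\<in>UNIV. \<Sum>j\<in>UNIV. s $ i * s $ j * (real n * (\<integral>x. Y n x $ i * Y n x $ j \<partial>\<mu>)))" for n
    unfolding sq using int by (simp add: Bochner_Integration.integral_sum sum_distrib_left mult_ac)
  moreover have "(\<lambda>n. \<Sum>i\<in>UNIV. \<Sum>j\<in>UNIV. s $ i * s $ j * (real n * (\<integral>x. Y n x $ i * Y n x $ j \<partial>\<mu>)))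
      \<longlonglongrightarrow> (\<Sum>i\<in>UNIV. \<Sum>j\<in>UNIV. s $ i * s $ j * S $ i $ j)"
    by (intro tendsto_intros cov)
  moreover have "(\<Sum>i\<in>UNIV. \<Sum>j\<in>UNIV. s $ i * s $ j * S $ i $ j) = s \<bullet> (S *v s)"
    by (simp add: inner_vec_def matrix_vector_mult_def sum_distrib_left mult_ac)
  ultimately show ?thesis by simp
qed

text \<open>
  The characteristic function of the row sum at \<open>s\<close> is the \<open>n\<close>-th power of that of a single
  summand's projection to \<open>s\<close>, so the one-dimensional estimate applies for each \<open>s\<close>.
\<close>

lemma (in prob_space) multivariate_triangular_clt:
  fixes \<mu> :: "'b::topological_space measure" and Y :: "nat \<Rightarrow> 'b \<Rightarrow> real ^ 'd::finite"
  assumes indep: "indep_vars (\<lambda>_. borel) Xs {1..}"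
    and law: "\<And>j. j \<ge> 1 \<Longrightarrow> distr M borel (Xs j) = \<mu>"
    and Y [measurable]: "\<And>n. Y n \<in> borel_measurable borel"
    and bound: "\<And>n x. norm (Y n x) \<le> b n" "b \<longlonglongrightarrow> 0"
    and mean: "\<And>i. \<forall>\<^sub>F n in sequentially. (\<integral>x. Y n x $ i \<partial>\<mu>) = 0"
    and cov: "\<And>i j. (\<lambda>n. real n * (\<integral>x. Y n x $ i * Y n x $ j \<partial>\<mu>)) \<longlonglongrightarrow> S $ i $ j"
    and \<nu>: "is_mv_normal \<nu> 0 S"
  shows "weak_conv_borel (\<lambda>n. distr M borel (\<lambda>\<omega>. \<Sum>j\<in>{1..n}. Y n (Xs j \<omega>))) \<nu>"
proof -
  have Xs [measurable]: "Xs j \<in> borel_measurable M" if "j \<ge> 1" for j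
    using indep that unfolding indep_vars_def by auto
  have \<mu>_def: "\<mu> = distr M borel (Xs 1)" using law[of 1] by simp
  have \<mu>: "prob_space \<mu>" unfolding \<mu>_def by (rule prob_space_distr) simp
  interpret \<mu>: prob_space \<mu> by fact
  have sets_\<mu> [measurable_cong]: "sets \<mu> = sets borel" unfolding \<mu>_def by simp
  have [measurable]: "(\<lambda>\<omega>. \<Sum>j\<in>{1..n}. Y n (Xs j \<omega>)) \<in> borel_measurable M" for n
    by (intro borel_measurable_sum measurable_compose[OF Xs Y]) auto
  show ?thesis
  proof (rule multivariate_levy_continuity)
    show "prob_space (distr M borel (\<lambda>\<omega>. \<Sum>j\<in>{1..n}. Y n (Xs j \<omega>)))" for n
      by (rule prob_space_distr) measurable
    show "prob_space \<nu>" "sets \<nu> = sets borel" using mv_normal_law[OF \<nu>] by auto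
    fix s :: "real ^ 'd"
    define L where "L n = distr \<mu> borel (\<lambda>x. s \<bullet> Y n x)" for n
    have rd: "real_distribution (L n)" for n
      unfolding L_def by (intro \<mu>.real_distribution_distr) measurable
    have char_power: "(\<integral>x. iexp (s \<bullet> x) \<partial>distr M borel (\<lambda>\<omega>. \<Sum>j\<in>{1..n}. Y n (Xs j \<omega>))) = char (L n) 1 ^ n" for n
    proof -
      have "(\<integral>x. iexp (s \<bullet> x) \<partial>distr M borel (\<lambda>\<omega>. \<Sum>j\<in>{1..n}. Y n (Xs j \<omega>)))
          = char (distr M borel (\<lambda>\<omega>. \<Sum>j\<in>{1..n}. s \<bullet> Y n (Xs j \<omega>))) 1"
        unfolding char_def
        by (subst (1 2) integral_distr) (auto simp: inner_sum_right)
      also have "\<dots> = (\<Prod>j\<in>{1..n}. char (distr M borel (\<lambda>\<omega>. s \<bullet> Y n (Xs j \<omega>))) 1)"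
        by (intro char_distr_sum indep_vars_compose2[where X=Xs and M'="\<lambda>_. borel" and Y="\<lambda>_ x. s \<bullet> Y n x"] indep_vars_subset[OF indep]) auto
      also have "\<dots> = (\<Prod>j\<in>{1..n}. char (L n) 1)"
      proof (intro prod.cong refl)
        fix j assume "j \<in> {1..n}"
        then have j: "j \<ge> 1" by simp
        have "distr M borel (\<lambda>\<omega>. s \<bullet> Y n (Xs j \<omega>)) = distr (distr M borel (Xs j)) borel (\<lambda>x. s \<bullet> Y n x)"
          using j by (subst distr_distr) (auto simp: comp_def)
        then show "char (distr M borel (\<lambda>\<omega>. s \<bullet> Y n (Xs j \<omega>))) 1 = char (L n) 1"
          unfolding L_def law[OF j] by simp
      qed
      finally show ?thesis by simp
    qed
    have "(\<lambda>n. char (L n) 1 ^ n) \<longlonglongrightarrow> complex_of_real (exp (- (s \<bullet> (S *v s)) / 2))"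
    proof (rule tendsto_char_power_triangular[where b="\<lambda>n. norm s * b n", OF rd])
      have "\<bar>s \<bullet> Y n x\<bar> \<le> norm s * b n" for n x
        using Cauchy_Schwarz_ineq2[of s "Y n x"] mult_left_mono[OF bound(1)[of n x], of "norm s"] by simp
      then show "AE x in L n. \<bar>x\<bar> \<le> norm s * b n" for n
        unfolding L_def by (subst AE_distr_iff) auto
      show "(\<lambda>n. norm s * b n) \<longlonglongrightarrow> 0" using bound(2) by (rule tendsto_mult_right_zero)
      have "\<forall>\<^sub>F n in sequentially. \<forall>i\<in>UNIV. (\<integral>x. Y n x $ i \<partial>\<mu>) = 0"
        using mean by (intro eventually_ball_finite) auto
      then show "\<forall>\<^sub>F n in sequentially. (\<integral>x. x \<partial>L n) = 0"
      proof eventually_elim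
        case (elim n)
        have int: "integrable \<mu> (\<lambda>x. Y n x $ i)" for i
          using order_trans[OF component_le_norm_cart bound(1)]
          by (intro \<mu>.integrable_const_bound[where B="b n"]) auto
        have "(\<integral>x. x \<partial>L n) = (\<integral>x. s \<bullet> Y n x \<partial>\<mu>)" unfolding L_def by (subst integral_distr) auto
        also have "\<dots> = (\<Sum>i\<in>UNIV. s $ i * (\<integral>x. Y n x $ i \<partial>\<mu>))"
          unfolding inner_vec_def using int by (simp add: Bochner_Integration.integral_sum)
        finally show ?case using elim by simp
      qed
      have "(\<integral>x. x\<^sup>2 \<partial>L n) = (\<integral>x. (s \<bullet> Y n x)\<^sup>2 \<partial>\<mu>)" for n
        unfolding L_def by (subst integral_distr) auto
      then show "(\<lambda>n. real n * (\<integral>x. x\<^sup>2 \<partial>L n)) \<longlonglongrightarrow> s \<bullet> (S *v s)"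
        using tendsto_second_moment[OF \<mu> _ bound(1) cov] by simp
    qed
    then show "(\<lambda>n. \<integral>x. iexp (s \<bullet> x) \<partial>distr M borel (\<lambda>\<omega>. \<Sum>j\<in>{1..n}. Y n (Xs j \<omega>)))
        \<longlonglongrightarrow> (\<integral>x. iexp (s \<bullet> x) \<partial>\<nu>)"
      unfolding char_power mv_normal_law(3)[OF \<nu>] .
  qed simp
qed

section \<open>Order statistics and exceedance counts\<close>

lemma sorted_nth_le_iff:
  fixes xs :: "'a::linorder list"
  assumes "sorted xs" "m < length xs"
  shows "xs ! m \<le> t \<longleftrightarrow> m < length (filter (\<lambda>x. x \<le> t) xs)"
  using assms
proof (induction xs arbitrary: m)
  case (Cons a xs)
  show ?case
  proof (cases "a \<le> t")
    case True
    then show ?thesis using Cons by (cases m) auto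
  next
    case False
    then have f: "filter (\<lambda>x. x \<le> t) (a # xs) = []"
      using Cons.prems(1) by (auto simp: filter_empty_conv)
    have "a \<le> (a # xs) ! m"
      using Cons.prems by (cases m) auto
    with False show ?thesis unfolding f by simp
  qed
qed simp

text \<open>
  Sorting does not change how many of the values are at most \<open>t\<close>.
\<close>

lemma order_stat_le_iff:
  assumes "1 \<le> m" "m \<le> n"
  shows "order_stat m n x \<le> t \<longleftrightarrow> m \<le> card {j \<in> {1..n}. x j \<le> t}"
proof -
  have "order_stat m n x \<le> t \<longleftrightarrow> m - 1 < length (filter (\<lambda>y. y \<le> t) (sort (map x [1..<Suc n])))"
    unfolding order_stat_def using assms by (intro sorted_nth_le_iff) auto
  also have "length (filter (\<lambda>y. y \<le> t) (sort (map x [1..<Suc n]))) = length (filter (\<lambda>j. x j \<le> t) [1..<Suc n])"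
    by (simp add: filter_sort filter_map comp_def del: upt_Suc)
  also have "\<dots> = card {j \<in> {1..n}. x j \<le> t}"
    by (subst distinct_card[symmetric]) (auto intro!: arg_cong[where f=card] simp del: upt_Suc)
  finally show ?thesis using assms by auto
qed

text \<open>
  Sublevel sets of an order statistic are counting events.
\<close>

lemma borel_measurable_order_stat:
  assumes "1 \<le> m" "m \<le> n" and [measurable]: "\<And>j. j \<in> {1..n} \<Longrightarrow> Y j \<in> borel_measurable M"
  shows "(\<lambda>\<omega>. order_stat m n (\<lambda>j. Y j \<omega>)) \<in> borel_measurable M"
  unfolding borel_measurable_iff_le
proof
  fix t
  have card: "real (card {j \<in> {1..n}. Y j \<omega> \<le> t}) = (\<Sum>j\<in>{1..n}. indicator {..t} (Y j \<omega>))" for \<omega>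
    by (simp add: indicator_def sum.If_cases Int_def)
  have "{\<omega> \<in> space M. order_stat m n (\<lambda>j. Y j \<omega>) \<le> t}
      = {\<omega> \<in> space M. real m \<le> real (card {j \<in> {1..n}. Y j \<omega> \<le> t})}"
    by (simp add: order_stat_le_iff[OF assms(1,2)])
  also have "\<dots> = {\<omega> \<in> space M. real m \<le> (\<Sum>j\<in>{1..n}. indicator {..t} (Y j \<omega>))}"
    by (simp only: card)
  also have "\<dots> \<in> sets M" by measurable
  finally show "{\<omega> \<in> space M. order_stat m n (\<lambda>j. Y j \<omega>) \<le> t} \<in> sets M" .
qed

lemma borel_measurable_vec_lambda:
  fixes f :: "'d::finite \<Rightarrow> 'a \<Rightarrow> real"
  assumes [measurable]: "\<And>i. f i \<in> borel_measurable M"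
  shows "(\<lambda>\<omega>. \<chi> i. f i \<omega>) \<in> borel_measurable M"
  unfolding borel_measurable_euclidean_space[of "\<lambda>\<omega>. \<chi> i. f i \<omega>"]
  by (auto simp: Basis_vec_def inner_axis)

text \<open>
  The threshold \<open>1 - p\<close> is the value that \<open>t\<close> corresponds to before normalization. The choice of \<open>p\<close> gives
  \<open>n p = k - t sqrt k\<close>, so that centring the exceedance count by \<open>n p\<close> and dividing by
  \<open>sqrt k\<close> turns the bound \<open>k\<close> into exactly \<open>t\<close>. No approximation is involved.
\<close>

lemma normalized_order_stat_le_iff:
  assumes k: "1 \<le> k" "k < n" and p: "p = (real k - sqrt (real k) * t) / real n"
  shows "real n / sqrt (real k) * (order_stat (n - k) n x - (real n - real k) / real n) \<le> t
    \<longleftrightarrow> (\<Sum>j\<in>{1..n}. (indicator {1 - p<..} (x j) - p) / sqrt (real k)) \<le> t"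
proof -
  have sk: "sqrt (real k) > 0" "sqrt (real k) * sqrt (real k) = real k" and n: "real n > 0" using k by auto
  have "real n / sqrt (real k) * z \<le> t \<longleftrightarrow> z \<le> sqrt (real k) * t / real n" for z
    using sk n by (simp add: field_simps)
  then have "real n / sqrt (real k) * (order_stat (n - k) n x - (real n - real k) / real n) \<le> t
      \<longleftrightarrow> order_stat (n - k) n x \<le> (real n - real k) / real n + sqrt (real k) * t / real n"
    by (simp only: diff_le_eq add.commute)
  also have "(real n - real k) / real n + sqrt (real k) * t / real n = 1 - p"
    using n by (simp add: p field_simps)
  finally have "real n / sqrt (real k) * (order_stat (n - k) n x - (real n - real k) / real n) \<le> t
      \<longleftrightarrow> order_stat (n - k) n x \<le> 1 - p" .
  also have "\<dots> \<longleftrightarrow> n - k \<le> card {j \<in> {1..n}. x j \<le> 1 - p}"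
    using k by (intro order_stat_le_iff) auto
  also have "\<dots> \<longleftrightarrow> card {j \<in> {1..n}. 1 - p < x j} \<le> k"
  proof -
    have "{1..n} = {j \<in> {1..n}. x j \<le> 1 - p} \<union> {j \<in> {1..n}. 1 - p < x j}" by auto
    then have "card {1..n} = card ({j \<in> {1..n}. x j \<le> 1 - p} \<union> {j \<in> {1..n}. 1 - p < x j})"
      by (rule arg_cong)
    also have "\<dots> = card {j \<in> {1..n}. x j \<le> 1 - p} + card {j \<in> {1..n}. 1 - p < x j}"
      by (intro card_Un_disjoint) auto
    finally show ?thesis using card_atLeastAtMost[of 1 n] by linarith
  qed
  also have "\<dots> \<longleftrightarrow> real (card {j \<in> {1..n}. 1 - p < x j}) \<le> real k" by simp
  also have "real (card {j \<in> {1..n}. 1 - p < x j}) = (\<Sum>j\<in>{1..n}. indicator {1 - p<..} (x j))"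
    by (simp add: indicator_def sum.If_cases Int_def)
  also have "\<dots> \<le> real k \<longleftrightarrow> (\<Sum>j\<in>{1..n}. (indicator {1 - p<..} (x j) - p) / sqrt (real k)) \<le> t"
  proof -
    have "(\<Sum>j\<in>{1..n}. (indicator {1 - p<..} (x j) - p) / sqrt (real k))
        = ((\<Sum>j\<in>{1..n}. indicator {1 - p<..} (x j)) - real n * p) / sqrt (real k)"
      by (simp add: sum_divide_distrib[symmetric] sum_subtractf)
    also have "real n * p = real k - sqrt (real k) * t" using n by (simp add: p)
    finally show ?thesis by (simp add: pos_divide_le_eq[OF sk(1)] mult.commute)
  qed
  finally show ?thesis .
qed

section \<open>Norms on finite-dimensional space\<close>

lemma is_norm_le_norm:
  fixes N :: "real ^ 'd::finite \<Rightarrow> real"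
  assumes N: "is_norm N"
  shows "N x \<le> (\<Sum>i\<in>UNIV. N (axis i 1)) * norm x"
proof -
  have sub: "N (\<Sum>i\<in>I. g i) \<le> (\<Sum>i\<in>I. N (g i))" if "finite I" for I :: "'d set" and g
    using that
  proof (induction I)
    case (insert i I)
    have "N (g i + (\<Sum>i\<in>I. g i)) \<le> N (g i) + N (\<Sum>i\<in>I. g i)" using N by (simp add: is_norm_def)
    with insert show ?case by simp
  next
    case empty
    have "N 0 = 0" using N unfolding is_norm_def by blast
    then show ?case by simp
  qed
  have "x = (\<Sum>i\<in>UNIV. x $ i *\<^sub>R axis i 1)"
    by (simp add: vec_eq_iff axis_def if_distrib cong: if_cong)
  then have "N x \<le> (\<Sum>i\<in>UNIV. N (x $ i *\<^sub>R axis i 1))" using sub[of UNIV] by (metis finite_code)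
  also have "\<dots> = (\<Sum>i\<in>UNIV. \<bar>x $ i\<bar> * N (axis i 1))" using N by (simp add: is_norm_def)
  also have "\<dots> \<le> (\<Sum>i\<in>UNIV. norm x * N (axis i 1))"
    using N by (intro sum_mono mult_right_mono component_le_norm_cart) (auto simp: is_norm_def)
  finally show ?thesis by (simp add: sum_distrib_left mult.commute)
qed

lemma is_norm_continuous:
  fixes N :: "real ^ 'd::finite \<Rightarrow> real"
  assumes N: "is_norm N"
  shows "continuous_on UNIV N"
proof -
  define c where "c = (\<Sum>i\<in>UNIV. N (axis i 1))"
  have "\<bar>N x - N y\<bar> \<le> c * norm (x - y)" for x y
  proof -
    have tri: "N a \<le> N b + N (a - b)" for a b
      using N unfolding is_norm_def by (metis diff_add_cancel add.commute)
    have "N (y - x) = N (x - y)"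
      using N unfolding is_norm_def by (metis abs_minus_cancel abs_one minus_diff_eq mult_1 scaleR_minus1_left)
    then show ?thesis
      using tri[of x y] tri[of y x] is_norm_le_norm[OF N, of "x - y"] by (auto simp: c_def abs_le_iff)
  qed
  moreover have "c \<ge> 0" using N by (auto simp: c_def is_norm_def intro: sum_nonneg)
  ultimately have "c-lipschitz_on UNIV N" by (intro lipschitz_onI) (auto simp: dist_norm)
  then show ?thesis by (rule lipschitz_on_continuous_on)
qed

lemma norm_le_is_norm:
  fixes N :: "real ^ 'd::finite \<Rightarrow> real"
  assumes N: "is_norm N"
  obtains c where "c > 0" "\<And>x. norm x \<le> c * N x"
proof -
  have "\<exists>x\<in>sphere 0 1. \<forall>y\<in>sphere 0 1. N x \<le> N y"
  proof (rule continuous_attains_inf)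
    have "axis (SOME i. True) 1 \<in> sphere (0 :: real ^ 'd) 1" by (simp add: norm_axis_1)
    then show "sphere (0 :: real ^ 'd) 1 \<noteq> {}" by blast
  qed (auto intro: continuous_on_subset[OF is_norm_continuous[OF N]])
  then obtain x where x: "norm x = 1" "\<And>y. norm y = 1 \<Longrightarrow> N x \<le> N y" by auto
  from x(1) have "x \<noteq> 0" by auto
  with N have pos: "N x > 0" unfolding is_norm_def by (metis less_eq_real_def)
  show ?thesis
  proof
    show "1 / N x > 0" using pos by simp
    fix y
    show "norm y \<le> 1 / N x * N y"
    proof (cases "y = 0")
      case True
      then show ?thesis using N by (simp add: is_norm_def)
    next
      case False
      then have "N x \<le> N ((1 / norm y) *\<^sub>R y)" by (intro x) simp
      also have "\<dots> = N y / norm y" using N by (simp add: is_norm_def)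
      finally show ?thesis using pos False by (simp add: field_simps)
    qed
  qed
qed

section \<open>Tail behaviour of copulas\<close>

text \<open>
  The lower orthants generate the Borel sets and are closed under intersection.
\<close>

lemma measure_eq_if_joint_cdf_eq:
  fixes \<mu> \<nu> :: "(real ^ 'd::finite) measure"
  assumes \<mu>: "prob_space \<mu>" "sets \<mu> = sets borel" and \<nu>: "prob_space \<nu>" "sets \<nu> = sets borel"
    and eq: "joint_cdf \<mu> = joint_cdf \<nu>"
  shows "\<mu> = \<nu>"
proof -
  interpret \<mu>: prob_space \<mu> by fact
  interpret \<nu>: prob_space \<nu> by fact
  have s: "sets borel = sigma_sets UNIV (range (\<lambda>a::real ^ 'd. {..a}))"
    by (subst borel_eq_atMost) simp
  show ?thesis
  proof (rule measure_eqI_generator_eq)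
    show "Int_stable (range (\<lambda>a::real ^ 'd. {..a}))"
    proof (rule Int_stableI)
      fix a b :: "(real ^ 'd) set"
      assume "a \<in> range (\<lambda>a. {..a})" "b \<in> range (\<lambda>a. {..a})"
      then obtain x y where "a = {..x}" "b = {..y}" by blast
      then have "a \<inter> b = {..inf x y}" by auto
      then show "a \<inter> b \<in> range (\<lambda>a. {..a})" by blast
    qed
    show "emeasure \<mu> X = emeasure \<nu> X" if "X \<in> range (\<lambda>a::real ^ 'd. {..a})" for X
      using that fun_cong[OF eq] by (auto simp: joint_cdf_atMost \<mu>.emeasure_eq_measure \<nu>.emeasure_eq_measure)
    show "(\<Union>n::nat. {..\<chi> i. real n}) = (UNIV :: (real ^ 'd) set)"
    proof -
      have "\<exists>n::nat. \<forall>i. x $ i \<le> real n" for x :: "real ^ 'd"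
      proof -
        obtain n :: nat where "norm x \<le> real n" using real_arch_simple by blast
        then show ?thesis using component_le_norm_cart[of x] by (meson abs_le_D1 order_trans)
      qed
      then show ?thesis by (auto simp: less_eq_vec_def)
    qed
  qed (auto simp: \<mu> \<nu> s)
qed

text \<open>
  A copula is a distribution function of some law with uniform marginals, and its law is unique.
\<close>

lemma copula_law_uniform_marginals:
  fixes \<mu> :: "(real ^ 'd::finite) measure"
  assumes "prob_space \<mu>" "sets \<mu> = sets borel" "is_copula (joint_cdf \<mu>)"
  shows "distr \<mu> borel (\<lambda>x. x $ i) = uniform_measure lborel {0<..<1}"
  using assms measure_eq_if_joint_cdf_eq[of \<mu>] unfolding is_copula_def by metis

context
  fixes \<mu> :: "(real ^ 'd::finite) measure"
  assumes prob: "prob_space \<mu>" and sets: "sets \<mu> = sets borel"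
    and unif: "\<And>i. distr \<mu> borel (\<lambda>x. x $ i) = uniform_measure lborel {0<..<1}"
begin

lemma measure_uniform_marginal_gt:
  assumes "0 \<le> p" "p \<le> 1"
  shows "measure \<mu> {x. x $ i > 1 - p} = p"
proof -
  note [measurable_cong] = sets
  have "measure \<mu> {x. x $ i > 1 - p} = measure (distr \<mu> borel (\<lambda>x. x $ i)) {1 - p<..}"
    using sets_eq_imp_space_eq[OF sets]
    by (subst measure_distr) (auto intro!: arg_cong[where f="measure \<mu>"])
  also have "\<dots> = measure lborel ({0<..<1} \<inter> {1 - p<..}) / measure lborel {0<..<(1::real)}"
    unfolding unif by (rule measure_uniform_measure) auto
  also have "{0<..<1} \<inter> {1 - p<..} = {1 - p<..<1}" using assms by auto
  finally show ?thesis using assms by simp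
qed

lemma AE_uniform_marginal_le_1: "AE x in \<mu>. \<forall>i. x $ i \<le> 1"
proof -
  interpret prob_space \<mu> by (rule prob)
  note [measurable_cong] = sets
  have "AE x in \<mu>. x $ i \<le> 1" for i
  proof (rule AE_I')
    have "{x. x $ i > 1} \<in> sets \<mu>" by measurable
    then show "{x. x $ i > 1} \<in> null_sets \<mu>"
      using measure_uniform_marginal_gt[of 0 i] by (auto simp: null_sets_def emeasure_eq_measure)
  qed (auto simp: not_le)
  then show ?thesis by (simp add: AE_all_countable)
qed

text \<open>
  Inclusion-exclusion. Almost surely no component exceeds 1, so prescribing bounds on
  two components only means evaluating the distribution function with all other arguments equal to 1.
\<close>

lemma measure_joint_tail:
  assumes "i \<noteq> j" and p: "0 \<le> p" "p \<le> 1" and q: "0 \<le> q" "q \<le> 1"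
  shows "measure \<mu> {x. x $ i > 1 - p \<and> x $ j > 1 - q}
     = p + q - 1 + joint_cdf \<mu> (1 - (p *\<^sub>R axis i 1 + q *\<^sub>R axis j 1))"
proof -
  interpret prob_space \<mu> by (rule prob)
  note [measurable_cong] = sets
  have sp: "space \<mu> = UNIV" using sets_eq_imp_space_eq[OF sets] by simp
  let ?A = "{x :: real ^ 'd. x $ i > 1 - p}" and ?B = "{x :: real ^ 'd. x $ j > 1 - q}"
  have [measurable]: "?A \<in> sets \<mu>" "?B \<in> sets \<mu>" by measurable
  have u: "(1 - (p *\<^sub>R axis i 1 + q *\<^sub>R axis j 1)) $ l = (if l = i then 1 - p else if l = j then 1 - q else 1)" for l
    using assms(1) by (auto simp: axis_def)
  have "joint_cdf \<mu> (1 - (p *\<^sub>R axis i 1 + q *\<^sub>R axis j 1)) = prob (space \<mu> - (?A \<union> ?B))"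
    unfolding joint_cdf_def u
  proof (rule finite_measure_eq_AE)
    show "AE x in \<mu>. (x \<in> {x. \<forall>l. x $ l \<le> (if l = i then 1 - p else if l = j then 1 - q else 1)})
        = (x \<in> space \<mu> - (?A \<union> ?B))"
      using AE_uniform_marginal_le_1 by eventually_elim (use assms(1) in \<open>auto simp: sp not_less\<close>)
  qed measurable
  also have "\<dots> = 1 - prob (?A \<union> ?B)" by (rule prob_compl) measurable
  also have "prob (?A \<union> ?B) = prob ?A + prob ?B - prob (?A \<inter> ?B)"
    by (subst finite_measure_Union') (auto simp: finite_measure_Diff' Int_commute)
  also have "prob ?A = p" using p by (rule measure_uniform_marginal_gt)
  also have "prob ?B = q" using q by (rule measure_uniform_marginal_gt)
  also have "?A \<inter> ?B = {x. x $ i > 1 - p \<and> x $ j > 1 - q}" by auto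
  finally show ?thesis by simp
qed

text \<open>
  Here \<open>a\<close> is the common rate at which the two tail probabilities vanish. The
  \<open>D\<close>-norm is homogeneous and continuous, so it can be divided by \<open>a\<close> before passing to the limit. The
  error term is \<open>o(N w)\<close> for \<open>w = p e\<^sub>i + q e\<^sub>j\<close>, and \<open>N w / a\<close> converges for the same reason.
\<close>

lemma tendsto_joint_tail:
  fixes N D :: "real ^ 'd \<Rightarrow> real" and a p q :: "nat \<Rightarrow> real"
  assumes N: "is_norm N" and D: "is_norm D"
    and expansion: "(\<lambda>u. joint_cdf \<mu> u - (1 - D (1 - u))) \<in> o[at 1 within cbox 0 1](\<lambda>u. N (1 - u))"
    and "i \<noteq> j" and a: "\<forall>\<^sub>F n in sequentially. 0 < a n" "a \<longlonglongrightarrow> 0"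
    and p: "(\<lambda>n. p n / a n) \<longlonglongrightarrow> x" "x > 0" and q: "(\<lambda>n. q n / a n) \<longlonglongrightarrow> y" "y > 0"
  shows "(\<lambda>n. measure \<mu> {x. x $ i > 1 - p n \<and> x $ j > 1 - q n} / a n)
     \<longlonglongrightarrow> x + y - D (x *\<^sub>R axis i 1 + y *\<^sub>R axis j 1)"
proof -
  have range: "(\<forall>\<^sub>F n in sequentially. 0 < r n \<and> r n \<le> 1) \<and> r \<longlonglongrightarrow> 0"
    if r: "(\<lambda>n. r n / a n) \<longlonglongrightarrow> z" "z > 0" for r z
  proof -
    have "(\<lambda>n. r n / a n * a n) \<longlonglongrightarrow> z * 0" by (intro tendsto_mult r a)
    moreover have "\<forall>\<^sub>F n in sequentially. r n / a n * a n = r n"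
      using a(1) by eventually_elim simp
    ultimately have r0: "r \<longlonglongrightarrow> 0" by (simp add: tendsto_cong)
    have "\<forall>\<^sub>F n in sequentially. r n < 1" using r0 by (rule order_tendstoD) simp
    moreover have "\<forall>\<^sub>F n in sequentially. 0 < r n / a n" using r by (rule order_tendstoD)
    ultimately have "\<forall>\<^sub>F n in sequentially. 0 < r n \<and> r n \<le> 1"
      using a(1) by eventually_elim (auto simp: zero_less_divide_iff)
    with r0 show ?thesis by simp
  qed
  define w where "w n = p n *\<^sub>R axis i 1 + q n *\<^sub>R axis j (1::real)" for n
  define R where "R u = joint_cdf \<mu> u - (1 - D (1 - u))" for u
  have wc: "w n $ l = (if l = i then p n else if l = j then q n else 0)" for n l
    using \<open>i \<noteq> j\<close> by (auto simp: w_def axis_def)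
  have w0: "w \<longlonglongrightarrow> 0"
    unfolding w_def using range[OF p] range[OF q] by (auto intro!: tendsto_eq_intros)
  have wr: "\<forall>\<^sub>F n in sequentially. 1 - w n \<in> cbox 0 1 \<and> 1 - w n \<noteq> 1"
    using conjunct1[OF range[OF p]] conjunct1[OF range[OF q]]
  proof eventually_elim
    case (elim n)
    have "w n $ i \<noteq> 0" using elim by (simp add: wc)
    then have "w n \<noteq> 0" by (metis zero_index)
    with elim show ?case by (auto simp: mem_box_cart wc)
  qed
  have "filterlim (\<lambda>n. 1 - w n) (at 1 within cbox 0 1) sequentially"
    unfolding filterlim_at using wr w0 by (auto intro!: tendsto_eq_intros)
  with smalloD_tendsto[OF expansion] have "(\<lambda>n. R (1 - w n) / N (1 - (1 - w n))) \<longlonglongrightarrow> 0"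
    unfolding R_def by (rule filterlim_compose)
  then have R0: "(\<lambda>n. R (1 - w n) / N (w n)) \<longlonglongrightarrow> 0" by simp
  have scaled: "(\<lambda>n. F (w n) / a n) \<longlonglongrightarrow> F (x *\<^sub>R axis i 1 + y *\<^sub>R axis j 1)" if F: "is_norm F" for F
  proof -
    have "(\<lambda>n. (p n / a n) *\<^sub>R axis i 1 + (q n / a n) *\<^sub>R axis j (1::real)) \<longlonglongrightarrow> x *\<^sub>R axis i 1 + y *\<^sub>R axis j 1"
      by (intro tendsto_intros p q)
    then have "(\<lambda>n. F ((p n / a n) *\<^sub>R axis i 1 + (q n / a n) *\<^sub>R axis j 1)) \<longlonglongrightarrow> F (x *\<^sub>R axis i 1 + y *\<^sub>R axis j 1)"
      by (rule continuous_on_tendsto_compose[OF is_norm_continuous[OF F]]) auto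
    moreover have "\<forall>\<^sub>F n in sequentially. F ((p n / a n) *\<^sub>R axis i 1 + (q n / a n) *\<^sub>R axis j 1) = F (w n) / a n"
      using a(1)
    proof eventually_elim
      case (elim n)
      have "(p n / a n) *\<^sub>R axis i 1 + (q n / a n) *\<^sub>R axis j 1 = (1 / a n) *\<^sub>R w n"
        by (simp add: w_def scaleR_add_right)
      moreover have "F ((1 / a n) *\<^sub>R w n) = \<bar>1 / a n\<bar> * F (w n)" using F unfolding is_norm_def by blast
      ultimately show ?case using elim by simp
    qed
    ultimately show ?thesis by (simp add: tendsto_cong)
  qed
  have "(\<lambda>n. p n / a n + q n / a n - D (w n) / a n + R (1 - w n) / N (w n) * (N (w n) / a n))
      \<longlonglongrightarrow> x + y - D (x *\<^sub>R axis i 1 + y *\<^sub>R axis j 1) + 0 * N (x *\<^sub>R axis i 1 + y *\<^sub>R axis j 1)"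
    by (intro tendsto_intros p q scaled N D R0)
  moreover have "\<forall>\<^sub>F n in sequentially. p n / a n + q n / a n - D (w n) / a n + R (1 - w n) / N (w n) * (N (w n) / a n)
      = measure \<mu> {x. x $ i > 1 - p n \<and> x $ j > 1 - q n} / a n"
    using conjunct1[OF range[OF p]] conjunct1[OF range[OF q]] wr a(1)
  proof eventually_elim
    case (elim n)
    have "measure \<mu> {x. x $ i > 1 - p n \<and> x $ j > 1 - q n} = p n + q n - 1 + joint_cdf \<mu> (1 - w n)"
      unfolding w_def using elim \<open>i \<noteq> j\<close> by (intro measure_joint_tail) auto
    also have "\<dots> = p n + q n - D (w n) + R (1 - w n)" by (simp add: R_def)
    finally have 1: "measure \<mu> {x. x $ i > 1 - p n \<and> x $ j > 1 - q n} = p n + q n - D (w n) + R (1 - w n)" .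
    have "w n \<noteq> 0" using elim by auto
    then have "N (w n) \<noteq> 0" using N unfolding is_norm_def by blast
    then show ?case unfolding 1 by (simp add: add_divide_distrib diff_divide_distrib)
  qed
  ultimately show ?thesis by (simp add: tendsto_cong)
qed

end

section \<open>Moments of the exceedance indicators along intermediate sequences\<close>

text \<open>
  All components of \<open>k\<close> are of the same order, so each of them is comparable to the
  norm of the vector, whichever norm is used.
\<close>

lemma intermediate_sequence_limits:
  fixes k :: "nat \<Rightarrow> 'd::finite \<Rightarrow> nat" and N :: "real ^ 'd \<Rightarrow> real"
  assumes N: "is_norm N"
    and k_range: "\<And>n i. n \<ge> 2 \<Longrightarrow> k n i \<in> {1..n - 1}"
    and k_ratio: "\<And>i j. (\<lambda>n. real (k n i) / real (k n j)) \<longlonglongrightarrow> (\<kappa> i j)\<^sup>2"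
    and k_infinity: "filterlim (\<lambda>n. N (\<chi> i. real (k n i))) at_top sequentially"
    and k_intermediate: "(\<lambda>n. N (\<chi> i. real (k n i)) / real n) \<longlonglongrightarrow> 0"
    and \<kappa>_pos: "\<And>i j. \<kappa> i j > 0"
  shows "filterlim (\<lambda>n. real (k n i)) at_top sequentially"
    and "(\<lambda>n. real (k n i) / real n) \<longlonglongrightarrow> 0"
proof -
  define c where "c = (\<Sum>i\<in>UNIV. N (axis i 1)) + 1"
  have c: "c > 0" using N by (auto simp: c_def is_norm_def intro!: add_nonneg_pos sum_nonneg)
  define r where "r n = (\<Sum>l\<in>UNIV. real (k n l) / real (k n i))" for n
  define l where "l = (\<Sum>l\<in>UNIV. (\<kappa> l i)\<^sup>2)"
  have r: "r \<longlonglongrightarrow> l" unfolding r_def l_def by (intro tendsto_sum k_ratio)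
  have l: "l > 0" unfolding l_def by (intro sum_pos zero_less_power \<kappa>_pos) auto
  have "filterlim (\<lambda>n. inverse (c * r n) * N (\<chi> i. real (k n i))) at_top sequentially"
  proof (rule filterlim_tendsto_pos_mult_at_top[OF _ _ k_infinity])
    show "(\<lambda>n. inverse (c * r n)) \<longlonglongrightarrow> inverse (c * l)" using c l by (intro tendsto_intros r) auto
    show "0 < inverse (c * l)" using c l by simp
  qed
  moreover have "\<forall>\<^sub>F n in sequentially. inverse (c * r n) * N (\<chi> i. real (k n i)) \<le> real (k n i)"
    using eventually_ge_at_top[of 2] order_tendstoD(1)[OF r l]
  proof eventually_elim
    case (elim n)
    let ?x = "\<chi> i. real (k n i)"
    have "N ?x \<le> c * norm ?x"
      using is_norm_le_norm[OF N, of ?x] by (simp add: c_def distrib_right add_increasing2)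
    also have "norm ?x \<le> (\<Sum>l\<in>UNIV. real (k n l))" using norm_le_l1_cart[of ?x] by simp
    also have "\<dots> = real (k n i) * r n"
      using k_range[OF elim(1), of i] by (simp add: r_def sum_distrib_left)
    finally have "N ?x \<le> c * r n * real (k n i)" using c by (simp add: mult_ac)
    then show ?case using c elim by (simp add: field_simps)
  qed
  ultimately show "filterlim (\<lambda>n. real (k n i)) at_top sequentially" by (rule filterlim_at_top_mono)
  obtain c' where c': "c' > 0" "\<And>x. norm x \<le> c' * N x" using norm_le_is_norm[OF N] by blast
  show "(\<lambda>n. real (k n i) / real n) \<longlonglongrightarrow> 0"
  proof (rule Lim_null_comparison)
    show "(\<lambda>n. c' * (N (\<chi> i. real (k n i)) / real n)) \<longlonglongrightarrow> 0"
      using k_intermediate by (rule tendsto_mult_right_zero)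
    show "\<forall>\<^sub>F n in sequentially. norm (real (k n i) / real n) \<le> c' * (N (\<chi> i. real (k n i)) / real n)"
    proof (rule always_eventually, rule allI)
      fix n
      have "real (k n i) \<le> norm (\<chi> i. real (k n i))"
        using component_le_norm_cart[of "\<chi> i. real (k n i)" i] by simp
      then have "real (k n i) \<le> c' * N (\<chi> i. real (k n i))" using c'(2) order_trans by blast
      then show "norm (real (k n i) / real n) \<le> c' * (N (\<chi> i. real (k n i)) / real n)"
        by (simp add: divide_right_mono)
    qed
  qed
qed

lemma tail_indicator_moments:
  fixes \<mu> :: "(real ^ 'd::finite) measure"
  assumes \<mu>: "prob_space \<mu>" "sets \<mu> = sets borel"
    and unif: "\<And>i. distr \<mu> borel (\<lambda>x. x $ i) = uniform_measure lborel {0<..<1}"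
    and p: "0 \<le> p" "p \<le> 1" and q: "0 \<le> q" "q \<le> 1"
  shows "(\<integral>x. indicator {1 - p<..} (x $ i) - p \<partial>\<mu>) = 0"
    and "(\<integral>x. (indicator {1 - p<..} (x $ i) - p) * (indicator {1 - q<..} (x $ j) - q) \<partial>\<mu>)
      = measure \<mu> {x. x $ i > 1 - p \<and> x $ j > 1 - q} - p * q"
proof -
  interpret prob_space \<mu> by fact
  note [measurable_cong] = \<mu>(2)
  have sp: "space \<mu> = UNIV" using sets_eq_imp_space_eq[OF \<mu>(2)] by simp
  have I: "(\<lambda>x. indicator {1 - r<..} (x $ l) :: real) = indicator {x. x $ l > 1 - r}" for r and l :: 'd
    by (auto simp: indicator_def)
  have int: "integrable \<mu> (\<lambda>x. indicator {1 - r<..} (x $ l) :: real)" for r l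
    by (intro integrable_const_bound[where B=1]) auto
  have int2: "integrable \<mu> (\<lambda>x. indicator {1 - p<..} (x $ i) * indicator {1 - q<..} (x $ j) :: real)"
    by (intro integrable_const_bound[where B=1]) (auto simp: indicator_def)
  have m: "(\<integral>x. indicator {1 - r<..} (x $ l) \<partial>\<mu>) = r" if "0 \<le> r" "r \<le> 1" for r l
    unfolding I using measure_uniform_marginal_gt[OF \<mu> unif that, of l] by (simp add: sp)
  have m2: "(\<integral>x. indicator {1 - p<..} (x $ i) * indicator {1 - q<..} (x $ j) \<partial>\<mu>)
      = measure \<mu> {x. x $ i > 1 - p \<and> x $ j > 1 - q}"
  proof -
    have "(\<integral>x. indicator {1 - p<..} (x $ i) * indicator {1 - q<..} (x $ j) \<partial>\<mu>)
        = (\<integral>x. (indicator {x. x $ i > 1 - p \<and> x $ j > 1 - q} x :: real) \<partial>\<mu>)"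
      by (intro Bochner_Integration.integral_cong) (auto simp: indicator_def)
    then show ?thesis by (simp add: sp)
  qed
  show "(\<integral>x. indicator {1 - p<..} (x $ i) - p \<partial>\<mu>) = 0"
    using int m[OF p] by (simp add: prob_space)
  have "(\<integral>x. (indicator {1 - p<..} (x $ i) - p) * (indicator {1 - q<..} (x $ j) - q) \<partial>\<mu>)
      = (\<integral>x. indicator {1 - p<..} (x $ i) * indicator {1 - q<..} (x $ j) - q * indicator {1 - p<..} (x $ i)
          - p * indicator {1 - q<..} (x $ j) + p * q \<partial>\<mu>)"
    by (simp add: algebra_simps)
  also have "\<dots> = measure \<mu> {x. x $ i > 1 - p \<and> x $ j > 1 - q} - q * p - p * q + p * q"
    using int int2 m[OF p] m[OF q] m2 by (simp add: prob_space)
  finally show "(\<integral>x. (indicator {1 - p<..} (x $ i) - p) * (indicator {1 - q<..} (x $ j) - q) \<partial>\<mu>)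
      = measure \<mu> {x. x $ i > 1 - p \<and> x $ j > 1 - q} - p * q" by simp
qed

text \<open>
  The exceedance probability that belongs to the bound \<open>t\<close> for the normalized order
  statistics; it is a probability only for large \<open>n\<close>.
\<close>

definition tail_prob :: "(nat \<Rightarrow> 'd \<Rightarrow> nat) \<Rightarrow> real ^ 'd::finite \<Rightarrow> nat \<Rightarrow> 'd \<Rightarrow> real" where
  "tail_prob k t n i = (real (k n i) - sqrt (real (k n i)) * t $ i) / real n"

text \<open>
  One summand of the triangular array. Centring by \<open>tail_prob\<close>, which is the mean only once it
  lies in the unit interval, keeps the identity with the order statistics exact for every \<open>n \<ge> 2\<close>.
\<close>

definition tail_indicator :: "(nat \<Rightarrow> 'd \<Rightarrow> nat) \<Rightarrow> real ^ 'd::finite \<Rightarrow> nat \<Rightarrow> real ^ 'd \<Rightarrow> real ^ 'd" where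
  "tail_indicator k t n x = (\<chi> i. (indicator {1 - tail_prob k t n i<..} (x $ i) - tail_prob k t n i) / sqrt (real (k n i)))"

lemma tail_indicator_bound:
  "norm (tail_indicator k t n x) \<le> (\<Sum>i\<in>UNIV. (1 + \<bar>tail_prob k t n i\<bar>) / sqrt (real (k n i)))"
proof -
  have "norm (tail_indicator k t n x) \<le> (\<Sum>i\<in>UNIV. \<bar>tail_indicator k t n x $ i\<bar>)" by (rule norm_le_l1_cart)
  also have "\<dots> \<le> (\<Sum>i\<in>UNIV. (1 + \<bar>tail_prob k t n i\<bar>) / sqrt (real (k n i)))"
    by (intro sum_mono) (auto simp: tail_indicator_def indicator_def abs_divide intro!: divide_right_mono)
  finally show ?thesis .
qed

lemma tail_indicator_measurable [measurable]: "tail_indicator k t n \<in> borel_measurable borel"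
  unfolding tail_indicator_def by (intro borel_measurable_vec_lambda) measurable

context
  fixes k :: "nat \<Rightarrow> 'd::finite \<Rightarrow> nat" and \<kappa> :: "'d \<Rightarrow> 'd \<Rightarrow> real"
    and t :: "real ^ 'd"
  assumes k_range: "\<And>n i. n \<ge> 2 \<Longrightarrow> k n i \<in> {1..n - 1}"
    and k_ratio: "\<And>i j. (\<lambda>n. real (k n i) / real (k n j)) \<longlonglongrightarrow> (\<kappa> i j)\<^sup>2"
    and \<kappa>_pos: "\<And>i j. \<kappa> i j > 0"
    and k_top: "\<And>i. filterlim (\<lambda>n. real (k n i)) at_top sequentially"
    and k_small: "\<And>i. (\<lambda>n. real (k n i) / real n) \<longlonglongrightarrow> 0"
begin

lemma sqrt_k_at_top: "filterlim (\<lambda>n. sqrt (real (k n i))) at_infinity sequentially"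
  by (intro filterlim_at_top_imp_at_infinity filterlim_compose[OF sqrt_at_top k_top])

lemma tail_prob_relative: "(\<lambda>n. real n * tail_prob k t n i / real (k n i)) \<longlonglongrightarrow> 1"
proof -
  have "(\<lambda>n. 1 - t $ i / sqrt (real (k n i))) \<longlonglongrightarrow> 1 - 0"
    by (intro tendsto_intros tendsto_divide_0[OF tendsto_const] sqrt_k_at_top)
  moreover have "\<forall>\<^sub>F n in sequentially. 1 - t $ i / sqrt (real (k n i)) = real n * tail_prob k t n i / real (k n i)"
    using eventually_ge_at_top[of 2]
  proof eventually_elim
    case (elim n)
    have "sqrt (real (k n i)) > 0" "real (k n i) = sqrt (real (k n i)) * sqrt (real (k n i))"
      using k_range[OF elim, of i] by auto
    moreover have "real n * tail_prob k t n i = real (k n i) - sqrt (real (k n i)) * t $ i"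
      using elim by (simp add: tail_prob_def)
    moreover have "1 - y / s = (s * s - s * y) / (s * s)" if "s > 0" for s y :: real
      using that by (simp add: field_simps)
    ultimately show ?case by metis
  qed
  ultimately show ?thesis by (simp add: tendsto_cong)
qed

lemma tail_prob_0: "(\<lambda>n. tail_prob k t n i) \<longlonglongrightarrow> 0"
proof -
  have "(\<lambda>n. real n * tail_prob k t n i / real (k n i) * (real (k n i) / real n)) \<longlonglongrightarrow> 1 * 0"
    by (intro tendsto_mult tail_prob_relative k_small)
  moreover have "\<forall>\<^sub>F n in sequentially. real n * tail_prob k t n i / real (k n i) * (real (k n i) / real n) = tail_prob k t n i"
    using eventually_ge_at_top[of 2]
  proof eventually_elim
    case (elim n)
    then show ?case using k_range[OF elim, of i] by auto
  qed
  ultimately show ?thesis by (simp add: tendsto_cong)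
qed

lemma tail_prob_range: "\<forall>\<^sub>F n in sequentially. 0 \<le> tail_prob k t n i \<and> tail_prob k t n i \<le> 1"
proof -
  have "\<forall>\<^sub>F n in sequentially. tail_prob k t n i < 1" using tail_prob_0 by (rule order_tendstoD) simp
  moreover have "\<forall>\<^sub>F n in sequentially. 0 < real n * tail_prob k t n i / real (k n i)"
    using tail_prob_relative by (rule order_tendstoD) simp
  ultimately show ?thesis
    by eventually_elim (auto simp: zero_less_divide_iff zero_less_mult_iff)
qed

text \<open>
  Measures the exceedance probability of the \<open>i\<close>-th component on the scale that
  normalizes the covariance of the \<open>i\<close>-th and the \<open>j\<close>-th component.
\<close>

lemma tail_prob_ratio:
  "(\<lambda>n. tail_prob k t n i / (sqrt (real (k n i)) * sqrt (real (k n j)) / real n)) \<longlonglongrightarrow> \<kappa> i j"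
proof -
  have "(\<lambda>n. sqrt (real (k n i) / real (k n j)) - t $ i / sqrt (real (k n j))) \<longlonglongrightarrow> sqrt ((\<kappa> i j)\<^sup>2) - 0"
    by (intro tendsto_intros k_ratio tendsto_divide_0[OF tendsto_const] sqrt_k_at_top)
  moreover have "\<forall>\<^sub>F n in sequentially. sqrt (real (k n i) / real (k n j)) - t $ i / sqrt (real (k n j))
      = tail_prob k t n i / (sqrt (real (k n i)) * sqrt (real (k n j)) / real n)"
    using eventually_ge_at_top[of 2]
  proof eventually_elim
    case (elim n)
    have "sqrt (real (k n i)) > 0" "real (k n i) = sqrt (real (k n i)) * sqrt (real (k n i))" "sqrt (real (k n j)) > 0"
      using k_range[OF elim, of i] k_range[OF elim, of j] by auto
    then show ?case using elim by (simp add: tail_prob_def real_sqrt_divide field_simps)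
  qed
  ultimately show ?thesis using \<kappa>_pos[of i j] by (simp add: tendsto_cong)
qed

lemma tail_indicator_bound_0:
  "(\<lambda>n. \<Sum>i\<in>UNIV. (1 + \<bar>tail_prob k t n i\<bar>) / sqrt (real (k n i))) \<longlonglongrightarrow> 0"
proof -
  have "(\<lambda>n. \<Sum>i\<in>UNIV. (1 + \<bar>tail_prob k t n i\<bar>) / sqrt (real (k n i))) \<longlonglongrightarrow> (\<Sum>i\<in>(UNIV::'d set). 0)"
    by (intro tendsto_sum tendsto_divide_0[OF tendsto_add[OF tendsto_const tendsto_rabs[OF tail_prob_0]] sqrt_k_at_top])
  then show ?thesis by simp
qed

context
  fixes \<mu> :: "(real ^ 'd) measure" and N D :: "real ^ 'd \<Rightarrow> real"
  assumes prob: "prob_space \<mu>" and sets: "sets \<mu> = sets borel"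
    and unif: "\<And>i. distr \<mu> borel (\<lambda>x. x $ i) = uniform_measure lborel {0<..<1}"
    and N: "is_norm N" and D: "is_norm D"
    and expansion: "(\<lambda>u. joint_cdf \<mu> u - (1 - D (1 - u))) \<in> o[at 1 within cbox 0 1](\<lambda>u. N (1 - u))"
begin

lemma tail_indicator_mean: "\<forall>\<^sub>F n in sequentially. (\<integral>x. tail_indicator k t n x $ i \<partial>\<mu>) = 0"
  using tail_prob_range[of i]
proof eventually_elim
  case (elim n)
  then show ?case
    using tail_indicator_moments(1)[OF prob sets unif, where p="tail_prob k t n i" and q=0 and i=i]
    by (simp add: tail_indicator_def)
qed

text \<open>
  The products of the means are of smaller order than the joint exceedance probabilities, so
  only the latter contribute to the limit. On the diagonal there is just one exceedance, of probability \<open>p\<close>.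
\<close>

lemma tail_indicator_covariance:
  "(\<lambda>n. real n * (\<integral>x. tail_indicator k t n x $ i * tail_indicator k t n x $ j \<partial>\<mu>))
    \<longlonglongrightarrow> (if i = j then 1 else \<kappa> i j + \<kappa> j i - D (\<kappa> i j *\<^sub>R axis i 1 + \<kappa> j i *\<^sub>R axis j 1))"
proof -
  define p where "p n = tail_prob k t n i" for n
  define q where "q n = tail_prob k t n j" for n
  define a where "a n = sqrt (real (k n i)) * sqrt (real (k n j)) / real n" for n
  define m where "m n = measure \<mu> {x. x $ i > 1 - p n \<and> x $ j > 1 - q n}" for n
  have apos: "\<forall>\<^sub>F n in sequentially. 0 < a n"
    using eventually_ge_at_top[of 2]
  proof eventually_elim
    case (elim n)
    then show ?case using k_range[OF elim, of i] k_range[OF elim, of j] by (auto simp: a_def)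
  qed
  have moment: "\<forall>\<^sub>F n in sequentially. m n / a n - p n / a n * q n
      = real n * (\<integral>x. tail_indicator k t n x $ i * tail_indicator k t n x $ j \<partial>\<mu>)"
    using tail_prob_range[of i] tail_prob_range[of j]
  proof eventually_elim
    case (elim n)
    have "(\<integral>x. tail_indicator k t n x $ i * tail_indicator k t n x $ j \<partial>\<mu>)
        = (\<integral>x. (indicator {1 - p n<..} (x $ i) - p n) * (indicator {1 - q n<..} (x $ j) - q n) / (sqrt (real (k n i)) * sqrt (real (k n j))) \<partial>\<mu>)"
      by (simp add: tail_indicator_def p_def q_def)
    also have "\<dots> = (m n - p n * q n) / (sqrt (real (k n i)) * sqrt (real (k n j)))"
      using tail_indicator_moments(2)[OF prob sets unif, of "p n" "q n" i j] elim by (simp add: m_def p_def q_def)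
    finally show ?case by (simp add: a_def diff_divide_distrib right_diff_distrib mult_ac)
  qed
  have p: "(\<lambda>n. p n / a n) \<longlonglongrightarrow> \<kappa> i j" unfolding p_def a_def by (rule tail_prob_ratio)
  have q: "(\<lambda>n. q n / a n) \<longlonglongrightarrow> \<kappa> j i"
    unfolding q_def a_def using tail_prob_ratio[of j i] by (simp add: mult.commute)
  have q0: "q \<longlonglongrightarrow> 0" unfolding q_def by (rule tail_prob_0)
  have "(\<lambda>n. m n / a n) \<longlonglongrightarrow> (if i = j then 1 else \<kappa> i j + \<kappa> j i - D (\<kappa> i j *\<^sub>R axis i 1 + \<kappa> j i *\<^sub>R axis j 1))"
  proof (cases "i = j")
    case True
    have "\<forall>\<^sub>F n in sequentially. real n * tail_prob k t n i / real (k n i) = m n / a n"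
      using tail_prob_range[of i]
    proof eventually_elim
      case (elim n)
      then have "m n = p n"
        using True measure_uniform_marginal_gt[OF prob sets unif, of "p n" i] by (simp add: m_def p_def q_def)
      then show ?case using True by (simp add: a_def p_def)
    qed
    with tail_prob_relative[of i] True show ?thesis by (simp add: tendsto_cong)
  next
    case False
    have "(\<lambda>n. sqrt (real (k n i) / real n) * sqrt (real (k n j) / real n)) \<longlonglongrightarrow> sqrt 0 * sqrt 0"
      by (intro tendsto_intros k_small)
    then have "a \<longlonglongrightarrow> 0" by (simp add: a_def[abs_def] real_sqrt_divide)
    then show ?thesis
      unfolding m_def using False tendsto_joint_tail[OF prob sets unif N D expansion False apos _ p \<kappa>_pos q \<kappa>_pos]
      by simp
  qed
  then have "(\<lambda>n. m n / a n - p n / a n * q n)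
      \<longlonglongrightarrow> (if i = j then 1 else \<kappa> i j + \<kappa> j i - D (\<kappa> i j *\<^sub>R axis i 1 + \<kappa> j i *\<^sub>R axis j 1)) - \<kappa> i j * 0"
    by (intro tendsto_intros p q0)
  with moment show ?thesis by (simp add: tendsto_cong)
qed

end

end

section \<open>Asymptotic normality of intermediate order statistics\<close>

theorem theorem2p1:
  fixes M\<^sub>0 :: "'a measure" and X :: "'a \<Rightarrow> real ^ 'd::finite"
    and M :: "'b measure" and Xs :: "nat \<Rightarrow> 'b \<Rightarrow> real ^ 'd"
    and C D N :: "real ^ 'd \<Rightarrow> real"
    and k :: "nat \<Rightarrow> 'd \<Rightarrow> nat" and \<kappa> :: "'d \<Rightarrow> 'd \<Rightarrow> real"
  assumes N: "is_norm N"
    and M\<^sub>0: "prob_space M\<^sub>0" and X: "X \<in> borel_measurable M\<^sub>0"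
    and C: "is_copula C" and X_cdf: "joint_cdf (distr M\<^sub>0 borel X) = C"
    and D: "is_D_norm D"
    and expansion: "(\<lambda>u. C u - (1 - D (1 - u))) \<in> o[at 1 within cbox 0 1](\<lambda>u. N (1 - u))"
    and M: "prob_space M"
    and indep: "prob_space.indep_vars M (\<lambda>_. borel) Xs {1..}"
    and copies: "\<And>j. j \<ge> 1 \<Longrightarrow> distr M borel (Xs j) = distr M\<^sub>0 borel X"
    and k_range: "\<And>n i. n \<ge> 2 \<Longrightarrow> k n i \<in> {1..n - 1}"
    and \<kappa>_pos: "\<And>i j. \<kappa> i j > 0"
    and k_ratio: "\<And>i j. (\<lambda>n. real (k n i) / real (k n j)) \<longlonglongrightarrow> (\<kappa> i j)\<^sup>2"
    and k_infinity: "filterlim (\<lambda>n. N (\<chi> i. real (k n i))) at_top sequentially"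
    and k_intermediate: "(\<lambda>n. N (\<chi> i. real (k n i)) / real n) \<longlonglongrightarrow> 0"
  shows "\<exists>\<nu>. is_mv_normal \<nu> 0
           (\<chi> i j. if i = j then 1
                    else \<kappa> i j + \<kappa> j i - D (\<kappa> i j *\<^sub>R axis i 1 + \<kappa> j i *\<^sub>R axis j 1)) \<and>
         weak_conv_borel
           (\<lambda>n. distr M borel (\<lambda>\<omega>. \<chi> i.
              real n / sqrt (real (k n i)) *
              (order_stat (n - k n i) n (\<lambda>j. Xs j \<omega> $ i) - (real n - real (k n i)) / real n)))
           \<nu>"
proof -
  interpret M: prob_space M by (rule M)
  interpret M\<^sub>0: prob_space M\<^sub>0 by (rule M\<^sub>0)
  define \<mu> where "\<mu> = distr M\<^sub>0 borel X"
  have \<mu>: "prob_space \<mu>" "sets \<mu> = sets borel"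
    unfolding \<mu>_def using X by (auto intro: M\<^sub>0.prob_space_distr)
  interpret \<mu>: prob_space \<mu> by (rule \<mu>)
  have cdf: "joint_cdf \<mu> = C" unfolding \<mu>_def by (rule X_cdf)
  have unif: "distr \<mu> borel (\<lambda>x. x $ i) = uniform_measure lborel {0<..<1}" for i
    using copula_law_uniform_marginals[OF \<mu>] C cdf by simp
  have exp\<mu>: "(\<lambda>u. joint_cdf \<mu> u - (1 - D (1 - u))) \<in> o[at 1 within cbox 0 1](\<lambda>u. N (1 - u))"
    unfolding cdf by (rule expansion)
  have D_norm: "is_norm D" using D by (simp add: is_D_norm_def)
  have k_lims: "filterlim (\<lambda>n. real (k n i)) at_top sequentially" "(\<lambda>n. real (k n i) / real n) \<longlonglongrightarrow> 0" for i
    using intermediate_sequence_limits[OF N k_range k_ratio k_infinity k_intermediate \<kappa>_pos, of i] by simp_all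
  note tail_facts = k_range k_ratio \<kappa>_pos k_lims
  have Xs [measurable]: "Xs j \<in> borel_measurable M" if "j \<ge> 1" for j
    using indep that unfolding M.indep_vars_def by auto
  \<comment> \<open>The limiting covariance does not depend on the bound \<open>t\<close>, although the array does.\<close>
  define S :: "real ^ 'd ^ 'd" where
    "S = (\<chi> i j. if i = j then 1 else \<kappa> i j + \<kappa> j i - D (\<kappa> i j *\<^sub>R axis i 1 + \<kappa> j i *\<^sub>R axis j 1))"
  have cov: "(\<lambda>n. real n * (\<integral>x. tail_indicator k t n x $ i * tail_indicator k t n x $ j \<partial>\<mu>)) \<longlonglongrightarrow> S $ i $ j" for t i j
    using tail_indicator_covariance[where k=k and \<kappa>=\<kappa> and t=t and i=i and j=j, OF tail_facts \<mu> unif N D_norm exp\<mu>] by (simp add: S_def)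
  have meas: "tail_indicator k t n \<in> borel_measurable \<mu>" for t n
    using tail_indicator_measurable[of k t n] by (simp cong: measurable_cong_sets add: \<mu>(2))
  have S_sym: "S $ i $ j = S $ j $ i" for i j by (simp add: S_def add.commute)
  have S_psd: "0 \<le> s \<bullet> (S *v s)" for s
  proof (rule LIMSEQ_le_const)
    \<comment> \<open>Any \<open>t\<close> would do here; 0 is the simplest.\<close>
    show "(\<lambda>n. real n * (\<integral>x. (s \<bullet> tail_indicator k 0 n x)\<^sup>2 \<partial>\<mu>)) \<longlonglongrightarrow> s \<bullet> (S *v s)"
      by (rule tendsto_second_moment[OF \<mu>(1) meas tail_indicator_bound cov])
  qed auto
  obtain \<nu> where \<nu>: "is_mv_normal \<nu> 0 S" using exists_mv_normal[OF S_sym S_psd] by blast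
  define F where "F n \<omega> = (\<chi> i. real n / sqrt (real (k n i)) *
      (order_stat (n - k n i) n (\<lambda>j. Xs j \<omega> $ i) - (real n - real (k n i)) / real n))" for n \<omega>
  have F [measurable]: "F n \<in> borel_measurable M" if "n \<ge> 2" for n
    unfolding F_def
  proof (intro borel_measurable_vec_lambda borel_measurable_times borel_measurable_diff borel_measurable_const borel_measurable_order_stat)
    fix i
    show "1 \<le> n - k n i" using k_range[OF that, of i] that by auto
    show "(\<lambda>\<omega>. Xs j \<omega> $ i) \<in> borel_measurable M" if "j \<in> {1..n}" for j
      using that by (intro borel_measurable_vec_nth_comp Xs) auto
  qed simp
  have cdf_eq: "joint_cdf (distr M borel (F n)) t
      = joint_cdf (distr M borel (\<lambda>\<omega>. \<Sum>j\<in>{1..n}. tail_indicator k t n (Xs j \<omega>))) t" if n: "n \<ge> 2" for n t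
  proof -
    have [measurable]: "(\<lambda>\<omega>. \<Sum>j\<in>{1..n}. tail_indicator k t n (Xs j \<omega>)) \<in> borel_measurable M"
      by (intro borel_measurable_sum measurable_compose[OF Xs tail_indicator_measurable]) auto
    have k_bounds: "1 \<le> k n i" "k n i < n" for i using k_range[OF n, of i] n by auto
    have "F n \<omega> \<le> t \<longleftrightarrow> (\<Sum>j\<in>{1..n}. tail_indicator k t n (Xs j \<omega>)) \<le> t" for \<omega>
      unfolding less_eq_vec_def F_def tail_indicator_def sum_component vec_lambda_beta
      by (intro all_cong1 normalized_order_stat_le_iff k_bounds) (simp add: tail_prob_def)
    then show ?thesis
      unfolding joint_cdf_atMost using F[OF n] by (simp add: measure_distr vimage_def)
  qed
  have cdf_conv: "(\<lambda>n. joint_cdf (distr M borel (F n)) t) \<longlonglongrightarrow> joint_cdf \<nu> t" for t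
  proof -
    have "(\<lambda>n. joint_cdf (distr M borel (\<lambda>\<omega>. \<Sum>j\<in>{1..n}. tail_indicator k t n (Xs j \<omega>))) t) \<longlonglongrightarrow> joint_cdf \<nu> t"
    proof (rule tendsto_joint_cdf_if_weak_conv)
      show "weak_conv_borel (\<lambda>n. distr M borel (\<lambda>\<omega>. \<Sum>j\<in>{1..n}. tail_indicator k t n (Xs j \<omega>))) \<nu>"
        using tail_indicator_mean[where k=k and \<kappa>=\<kappa> and t=t, OF tail_facts \<mu> unif N D_norm exp\<mu>]
          tail_indicator_bound_0[where k=k and \<kappa>=\<kappa> and t=t, OF tail_facts]
        by (intro M.multivariate_triangular_clt[OF indep _ tail_indicator_measurable tail_indicator_bound _ _ cov \<nu>])
           (auto simp: copies \<mu>_def)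
      show "prob_space (distr M borel (\<lambda>\<omega>. \<Sum>j\<in>{1..n}. tail_indicator k t n (Xs j \<omega>)))" for n
        by (intro M.prob_space_distr borel_measurable_sum measurable_compose[OF Xs tail_indicator_measurable]) auto
      show "measure \<nu> {x. x $ i = t $ i} = 0" for i
        by (rule mv_normal_hyperplane_null[OF \<nu>]) (simp add: S_def)
    qed (use mv_normal_law[OF \<nu>] in auto)
    moreover have "\<forall>\<^sub>F n in sequentially. joint_cdf (distr M borel (\<lambda>\<omega>. \<Sum>j\<in>{1..n}. tail_indicator k t n (Xs j \<omega>))) t
        = joint_cdf (distr M borel (F n)) t"
      using eventually_ge_at_top[of 2] by eventually_elim (simp only: cdf_eq)
    ultimately show ?thesis by (rule Lim_transform_eventually)
  qed
  \<comment> \<open>For \<open>n < 2\<close> nothing is known about \<open>k n\<close>, so \<open>F n\<close> might not be measurable.\<close>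
  have "weak_conv_borel (\<lambda>n. distr M borel (F (n + 2))) \<nu>"
  proof (rule weak_conv_borel_if_joint_cdf)
    show "prob_space (distr M borel (F (n + 2)))" for n by (rule M.prob_space_distr) simp
    show "(\<lambda>n. joint_cdf (distr M borel (F (n + 2))) u) \<longlonglongrightarrow> joint_cdf \<nu> u" for u
      using cdf_conv by (rule LIMSEQ_ignore_initial_segment)
  qed (use mv_normal_law[OF \<nu>] in auto)
  then have "weak_conv_borel (\<lambda>n. distr M borel (F n)) \<nu>"
    unfolding weak_conv_borel_def by (blast intro: LIMSEQ_offset)
  with \<nu> show ?thesis unfolding S_def F_def by blast
qed

end
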